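(* Let $J,L\subseteq\Phi^-$ be closed with $J\cap L=\emptyset$, $K=J\cup L$ and $U_J\trianglelefteq U_K$. Let $V=V_J$ and let $f:U_K\to V_J$ be the 1-cocycle $f(g)=\rho(g^{-1})g-E$. Then the group algebra $\mathbb CV\cong\mathbb C^V$ of the finite abelian group $(V,+)$ is a right $\mathbb CU_K$-module satisfying the following: 1) $U_K$ acts on the $\mathbb C$-basis $\hat V=\mathrm{Hom}((V,+),\mathbb C^* )$ monomially, the action of $g\in U_K$ on $\chi\in\hat V$ being given by $\chi g=\chi(f(g^{-1}))\,\chi.g$, where $\chi.g\in\hat V$ is defined by $\chi.g(A)=\chi(A\circ g^{-1})$ for $A\in V$. 2) The $\mathbb CU_K$-module $\mathbb CV\cong\mathbb C^V$ is isomorphic to $\mathrm{Ind}_{U_L}^{U_K}\mathbb C$, the trivial $\mathbb CU_L$-module induced to $U_K$. 3) The restriction $\mathrm{Res}^{U_K}_{U_J}(\mathbb C^V)$ is isomorphic to the right regular $\mathbb CU_J$-module. 4) For $g\in U_L$ and $\chi\in\hat V$ we have $f(g^{-1})=0$, hence $\chi(f(g^{-1}))=1$. So $U_L$ acts on $\hat V$ by permutations.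
   Context: $\mathbb F_q$ is the field with $q$ elements ($q$ a prime power), $M_n(q)$ the algebra of $n\times n$-matrices over $\mathbb F_q$, $E$ the identity matrix, $\Phi^-=\{(i,j):1\leq j<i\leq n\}$. For $A\in M_n(q)$, $\mathrm{supp}(A)=\{(i,j):A_{ij}\neq0\}$. For $S\subseteq\Phi^-$, $V_S=\{A\in M_n(q):\mathrm{supp}(A)\subseteq S\}$; $S$ is closed if $(i,j),(j,k)\in S$ implies $(i,k)\in S$, and then $U_S=\{E+A: A\in V_S\}$ is a group (pattern subgroup of the lower unitriangular group). The hypothesis $U_J\trianglelefteq U_K$ includes that $K$ is closed, so that $U_K$ is a group; then $U_K=U_J\rtimes U_L$. The natural projection $\tilde\rho:V_K\to V_L$ (setting all entries at positions in $J$ to zero) is an $\mathbb F_q$-algebra homomorphism with kernel the ideal $V_J$, and $\rho:U_K\to U_L$, $\rho(u)=\tilde\rho(u-E)+E$, is a group epimorphism with kernel $U_J$ and $\rho|_{U_L}=\mathrm{id}$. $U_K$ acts on $V_J$ from the right by $\mathbb F_q$-automorphisms via $A\circ g=\rho(g^{-1})Ag$. A 1-cocycle here is a map $f:U_K\to V_J$ with $f(xg)=f(x)\circ g+f(g)$. The group algebra $\mathbb CV$ is identified with the function space $\mathbb C^V$ via $\tau\mapsto\sum_{v\in V}\tau(v)v$. *)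

theory Defs
  imports
    "HOL-Analysis.Analysis"
    "HOL-Algebra.Algebra"
    "HOL-Algebra.Free_Abelian_Groups"
    "HOL-Library.Function_Algebras"
begin

section \<open>Right modules, regular modules, extension of scalars\<close>

text \<open>
  HOL-Algebra only has modules over commutative rings.  The record \<open>module\<close> is reused for right
  modules over an arbitrary ring; the product of \<open>x\<close> with the scalar \<open>a\<close> from the right is written
  \<open>a \<odot>\<^bsub>M\<^esub> x\<close>, so that the associative law reads \<open>x(ab) = (xa)b\<close>.  As for library
  modules, the fields \<open>mult\<close> and \<open>one\<close> of the record are irrelevant.
\<close>

locale right_module = R?: ring R + M?: abelian_group M
  for R :: "('a, 'r) ring_scheme" (structure) and M :: "('a, 'b, 'm) module_scheme" (structure) +
  assumes act_closed:
      "a \<in> carrier R \<Longrightarrow> x \<in> carrier M \<Longrightarrow> a \<odot>\<^bsub>M\<^esub> x \<in> carrier M"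
    and act_add_scalar:
      "a \<in> carrier R \<Longrightarrow> b \<in> carrier R \<Longrightarrow> x \<in> carrier M \<Longrightarrow>
        (a \<oplus>\<^bsub>R\<^esub> b) \<odot>\<^bsub>M\<^esub> x = (a \<odot>\<^bsub>M\<^esub> x) \<oplus>\<^bsub>M\<^esub> (b \<odot>\<^bsub>M\<^esub> x)"
    and act_add:
      "a \<in> carrier R \<Longrightarrow> x \<in> carrier M \<Longrightarrow> y \<in> carrier M \<Longrightarrow>
        a \<odot>\<^bsub>M\<^esub> (x \<oplus>\<^bsub>M\<^esub> y) = (a \<odot>\<^bsub>M\<^esub> x) \<oplus>\<^bsub>M\<^esub> (a \<odot>\<^bsub>M\<^esub> y)"
    and act_mult:
      "a \<in> carrier R \<Longrightarrow> b \<in> carrier R \<Longrightarrow> x \<in> carrier M \<Longrightarrow>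
        (a \<otimes>\<^bsub>R\<^esub> b) \<odot>\<^bsub>M\<^esub> x = b \<odot>\<^bsub>M\<^esub> (a \<odot>\<^bsub>M\<^esub> x)"
    and act_one: "x \<in> carrier M \<Longrightarrow> \<one>\<^bsub>R\<^esub> \<odot>\<^bsub>M\<^esub> x = x"

definition right_module_isomorphic ::
    "('a, 'r) ring_scheme \<Rightarrow> ('a, 'b, 'm) module_scheme \<Rightarrow> ('a, 'c, 'k) module_scheme \<Rightarrow> bool" where
  "right_module_isomorphic R M N \<longleftrightarrow>
     right_module R M \<and> right_module R N \<and>
     (\<exists>h. bij_betw h (carrier M) (carrier N) \<and>
          (\<forall>x\<in>carrier M. \<forall>y\<in>carrier M. h (x \<oplus>\<^bsub>M\<^esub> y) = h x \<oplus>\<^bsub>N\<^esub> h y) \<and>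
          (\<forall>a\<in>carrier R. \<forall>x\<in>carrier M. h (a \<odot>\<^bsub>M\<^esub> x) = a \<odot>\<^bsub>N\<^esub> h x))"

definition regular_right_module :: "'a ring \<Rightarrow> ('a, 'a) module" where
  "regular_right_module R =
     \<lparr>carrier = carrier R, mult = mult R, one = one R,
      ring.zero = ring.zero R, ring.add = ring.add R,
      smult = (\<lambda>a x. x \<otimes>\<^bsub>R\<^esub> a)\<rparr>"

text \<open>
  For a subring \<open>R\<close> of \<open>S\<close> (same operations, smaller carrier) and a right \<open>R\<close>-module \<open>M\<close>, the tensor
  product \<open>M \<otimes>\<^sub>R S\<close>: the free abelian group on the pairs \<open>(m, s)\<close> modulo the subgroup generated
  by the differences that express biadditivity and \<open>m r \<otimes> s = m \<otimes> r s\<close>.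
\<close>

definition tensor_relations ::
    "('a, 'r) ring_scheme \<Rightarrow> ('a, 's) ring_scheme \<Rightarrow> ('a, 'b, 'm) module_scheme \<Rightarrow>
      ('b \<times> 'a \<Rightarrow>\<^sub>0 int) set" where
  "tensor_relations R S M =
     {frag_of (m \<oplus>\<^bsub>M\<^esub> m', s) - frag_of (m, s) - frag_of (m', s) | m m' s.
        m \<in> carrier M \<and> m' \<in> carrier M \<and> s \<in> carrier S} \<union>
     {frag_of (m, s \<oplus>\<^bsub>S\<^esub> s') - frag_of (m, s) - frag_of (m, s') | m s s'.
        m \<in> carrier M \<and> s \<in> carrier S \<and> s' \<in> carrier S} \<union>
     {frag_of (r \<odot>\<^bsub>M\<^esub> m, s) - frag_of (m, r \<otimes>\<^bsub>S\<^esub> s) | m r s.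
        m \<in> carrier M \<and> r \<in> carrier R \<and> s \<in> carrier S}"

definition tensor_group ::
    "('a, 'r) ring_scheme \<Rightarrow> ('a, 's) ring_scheme \<Rightarrow> ('a, 'b, 'm) module_scheme \<Rightarrow>
      ('b \<times> 'a \<Rightarrow>\<^sub>0 int) set monoid" where
  "tensor_group R S M =
     (let F = free_Abelian_group (carrier M \<times> carrier S)
      in F Mod generate F (tensor_relations R S M))"

text \<open>
  The right \<open>S\<close>-module structure on \<open>M \<otimes>\<^sub>R S\<close>, given by \<open>(m \<otimes> s) a = m \<otimes> s a\<close>.  The induced
  endomorphism of the free abelian group maps a coset \<open>x\<close> of the relation subgroup \<open>N\<close> into a single
  coset, which is the sum of \<open>N\<close> and the image of \<open>x\<close>.
\<close>

definition extend_scalars ::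
    "('a, 'r) ring_scheme \<Rightarrow> ('a, 's) ring_scheme \<Rightarrow> ('a, 'b, 'm) module_scheme \<Rightarrow>
      ('a, ('b \<times> 'a \<Rightarrow>\<^sub>0 int) set) module" where
  "extend_scalars R S M =
     (let F = free_Abelian_group (carrier M \<times> carrier S);
          N = generate F (tensor_relations R S M);
          T = tensor_group R S M
      in \<lparr>carrier = carrier T, mult = undefined, one = undefined,
          ring.zero = one T, ring.add = mult T,
          smult = (\<lambda>a x. N <#>\<^bsub>F\<^esub>
                     (frag_extend (\<lambda>(m, s). frag_of (m, s \<otimes>\<^bsub>S\<^esub> a)) ` x))\<rparr>)"


section \<open>Complex group algebras of finite groups\<close>

text \<open>
  Elements of the group algebra are coefficient functions, extended by \<open>0\<close> outside the group.  With
  this convention the group algebra of a subgroup is literally a subring of that of the group, and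
  restricting a module to it does not change the record.
\<close>

definition group_algebra :: "('g, 'x) monoid_scheme \<Rightarrow> ('g \<Rightarrow> complex) ring" where
  "group_algebra G =
     \<lparr>carrier = {a. \<forall>g. g \<notin> carrier G \<longrightarrow> a g = 0},
      mult = (\<lambda>a b g. \<Sum>x\<in>carrier G. \<Sum>y\<in>carrier G.
                        if x \<otimes>\<^bsub>G\<^esub> y = g then a x * b y else 0),
      one = (\<lambda>g. if g = \<one>\<^bsub>G\<^esub> then 1 else 0),
      ring.zero = (\<lambda>g. 0),
      ring.add = (\<lambda>a b g. a g + b g)\<rparr>"

definition group_elem :: "'g \<Rightarrow> 'g \<Rightarrow> complex" where
  "group_elem g = (\<lambda>h. if h = g then 1 else 0)"

definition trivial_module :: "('g, 'x) monoid_scheme \<Rightarrow> ('g \<Rightarrow> complex, complex) module" where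
  "trivial_module G =
     \<lparr>carrier = UNIV, mult = (*), one = 1, ring.zero = 0, ring.add = (+),
      smult = (\<lambda>a z. z * (\<Sum>g\<in>carrier G. a g))\<rparr>"

definition induced_module ::
    "'g monoid \<Rightarrow> 'g monoid \<Rightarrow> ('g \<Rightarrow> complex, 'b) module \<Rightarrow>
      ('g \<Rightarrow> complex, ('b \<times> ('g \<Rightarrow> complex) \<Rightarrow>\<^sub>0 int) set) module" where
  "induced_module H G M = extend_scalars (group_algebra H) (group_algebra G) M"

definition fun_scale :: "complex \<Rightarrow> ('a \<Rightarrow> complex) \<Rightarrow> 'a \<Rightarrow> complex" where
  "fun_scale c \<tau> = (\<lambda>v. c * \<tau> v)"

definition complex_basis :: "('a \<Rightarrow> complex) set \<Rightarrow> ('a \<Rightarrow> complex) set \<Rightarrow> bool" where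
  "complex_basis B W \<longleftrightarrow>
     \<not> Modules.module.dependent fun_scale B \<and> Modules.module.span fun_scale B = W"


section \<open>Characters of a finite abelian group\<close>

definition complex_units :: "complex monoid" where
  "complex_units = \<lparr>carrier = UNIV - {0}, mult = (*), one = 1\<rparr>"

text \<open>As elements of the group algebra, characters are extended by \<open>0\<close>.\<close>

definition characters :: "('g, 'x) monoid_scheme \<Rightarrow> ('g \<Rightarrow> complex) set" where
  "characters G = {\<psi> \<in> hom G complex_units. \<forall>g. g \<notin> carrier G \<longrightarrow> \<psi> g = 0}"


section \<open>Pattern groups\<close>

text \<open>
  The \<open>n\<close> row and column indices are the elements of a finite linearly ordered type \<open>'n\<close>, and the
  field with \<open>q\<close> elements is a finite field type \<open>'k\<close>.  Closedness of \<open>S\<close> is \<^term>\<open>trans S\<close>.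
\<close>

type_synonym ('k, 'n) sq_matrix = "'k^'n^'n"

definition Phi_minus :: "('n::{finite,linorder} \<times> 'n) set" where
  "Phi_minus = {(i, j). j < i}"

definition supp :: "('k::{field,finite}, 'n) sq_matrix \<Rightarrow> ('n::{finite,linorder} \<times> 'n) set" where
  "supp A = {(i, j). A $ i $ j \<noteq> 0}"

definition V_set :: "('n::{finite,linorder} \<times> 'n) set \<Rightarrow> ('k::{field,finite}, 'n) sq_matrix set" where
  "V_set S = {A. supp A \<subseteq> S}"

definition V_group :: "('n::{finite,linorder} \<times> 'n) set \<Rightarrow> ('k::{field,finite}, 'n) sq_matrix monoid" where
  "V_group S = \<lparr>carrier = V_set S, mult = (+), one = 0\<rparr>"

definition U_group :: "('n::{finite,linorder} \<times> 'n) set \<Rightarrow> ('k::{field,finite}, 'n) sq_matrix monoid" where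
  "U_group S = \<lparr>carrier = {mat 1 + A | A. A \<in> V_set S}, mult = (**), one = mat 1\<rparr>"

text \<open>In the following, \<open>K\<close> is always \<open>J \<union> L\<close>.\<close>

definition rho_lin ::
    "('n::{finite,linorder} \<times> 'n) set \<Rightarrow> ('k::{field,finite}, 'n) sq_matrix \<Rightarrow> ('k, 'n) sq_matrix" where
  "rho_lin J A = (\<chi> i j. if (i, j) \<in> J then 0 else A $ i $ j)"

definition rho ::
    "('n::{finite,linorder} \<times> 'n) set \<Rightarrow> ('k::{field,finite}, 'n) sq_matrix \<Rightarrow> ('k, 'n) sq_matrix" where
  "rho J u = rho_lin J (u - mat 1) + mat 1"

definition circ_act ::
    "('n::{finite,linorder} \<times> 'n) set \<Rightarrow> ('n \<times> 'n) set \<Rightarrow>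
      ('k::{field,finite}, 'n) sq_matrix \<Rightarrow> ('k, 'n) sq_matrix \<Rightarrow> ('k, 'n) sq_matrix" where
  "circ_act J L A g = rho J (inv\<^bsub>U_group (J \<union> L)\<^esub> g) ** A ** g"

definition cocycle ::
    "('n::{finite,linorder} \<times> 'n) set \<Rightarrow> ('n \<times> 'n) set \<Rightarrow> ('k::{field,finite}, 'n) sq_matrix \<Rightarrow> ('k, 'n) sq_matrix" where
  "cocycle J L g = rho J (inv\<^bsub>U_group (J \<union> L)\<^esub> g) ** g - mat 1"

definition dot_char ::
    "('n::{finite,linorder} \<times> 'n) set \<Rightarrow> ('n \<times> 'n) set \<Rightarrow>
      (('k::{field,finite}, 'n) sq_matrix \<Rightarrow> complex) \<Rightarrow> ('k, 'n) sq_matrix \<Rightarrow> ('k, 'n) sq_matrix \<Rightarrow> complex" where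
  "dot_char J L \<psi> g =
     (\<lambda>A. if A \<in> V_set J then \<psi> (circ_act J L A (inv\<^bsub>U_group (J \<union> L)\<^esub> g)) else 0)"

text \<open>
  The module \<open>\<complex>V\<close>: the complex-linear extension of the right action \<open>(v, g) \<mapsto> v \<circ> g + f g\<close> of
  \<open>U\<^sub>K\<close> on the set \<open>V\<close>.  On coefficient functions this is
  \<open>(\<tau> g) A = \<tau> (A \<circ> g\<inverse> + f (g\<inverse>))\<close>, because the cocycle identity makes
  \<open>A \<mapsto> A \<circ> g\<inverse> + f (g\<inverse>)\<close> the inverse of \<open>v \<mapsto> v \<circ> g + f g\<close>.  It is the only linear
  action with the values prescribed on the basis of characters.
\<close>

definition CV_module ::
    "('n::{finite,linorder} \<times> 'n) set \<Rightarrow> ('n \<times> 'n) set \<Rightarrow>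
      (('k::{field,finite}, 'n) sq_matrix \<Rightarrow> complex, ('k, 'n) sq_matrix \<Rightarrow> complex) module" where
  "CV_module J L =
     (let CV = group_algebra (V_group J); G = U_group (J \<union> L)
      in \<lparr>carrier = carrier CV, mult = mult CV, one = one CV,
          ring.zero = ring.zero CV, ring.add = ring.add CV,
          smult = (\<lambda>a \<tau> A. if A \<in> V_set J
                     then \<Sum>g\<in>carrier G. a g *
                            \<tau> (circ_act J L A (inv\<^bsub>G\<^esub> g) + cocycle J L (inv\<^bsub>G\<^esub> g))
                     else 0)\<rparr>)"

end

theory Submission
  imports Defs "HOL-Number_Theory.Cong"
begin

text \<open>
  Since \<open>E + (A \<circ> g + f g) = \<rho>(g\<inverse>) (E + A) g\<close>, the map \<open>(A, g) \<mapsto> A \<circ> g + f g\<close> is an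
  action of \<open>U\<^sub>K\<close> on the set \<open>V\<close>, and \<open>\<complex>V\<close> is its permutation module.  The orbit of \<open>0\<close> is all
  of \<open>V\<close> and its stabilizer is \<open>{g. f g = 0} = U\<^sub>L\<close>, which gives the induced module; \<open>U\<^sub>J\<close> acts
  regularly because \<open>f (E + A) = A\<close> for \<open>A \<in> V\<close>, which gives the regular module.  Characters are
  homomorphisms, so the translation by \<open>f (g\<inverse>)\<close> only contributes the scalar \<open>\<psi> (f (g\<inverse>))\<close>.
\<close>

section \<open>Group algebras and right modules\<close>

text \<open>Induction is taken literally as a tensor product, that is as a quotient of a free
  abelian group, so the work lies in bounding this quotient from above. Every group element is
  \<open>l \<otimes> k\<close> with \<open>l\<close> in the stabilizer and \<open>k\<close> a chosen
  coset representative. Moving \<open>l\<close> across the tensor sign brings each tensor to the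
  form 1 \<otimes> s with \<open>s\<close> supported on representatives, and such an
  \<open>s\<close> is the same thing as a function on the set acted upon. That the characters form a
  basis rests on there being enough of them to separate points. Matrix entries reduce this to one
  additive character of the field that is nontrivial at 1. Normality is used through elementary
  matrices: they turn it into the condition that \<open>J\<close> absorbs \<open>K\<close> from both
  sides under composition of positions. This is what makes \<rho> multiplicative.\<close>

lemma group_algebra_simps [simp]:
  "carrier (group_algebra G) = {a. \<forall>g. g \<notin> carrier G \<longrightarrow> a g = 0}"
  "a \<oplus>\<^bsub>group_algebra G\<^esub> b = (\<lambda>g. a g + b g)"
  "\<zero>\<^bsub>group_algebra G\<^esub> = (\<lambda>g. 0)"
  "\<one>\<^bsub>group_algebra G\<^esub> = (\<lambda>g. if g = \<one>\<^bsub>G\<^esub> then 1 else 0)"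
  by (simp_all add: group_algebra_def)

lemma group_algebra_mult:
  "(a \<otimes>\<^bsub>group_algebra G\<^esub> b) g =
     (\<Sum>x\<in>carrier G. \<Sum>y\<in>carrier G. if x \<otimes>\<^bsub>G\<^esub> y = g then a x * b y else 0)"
  by (simp add: group_algebra_def)

lemma (in monoid) group_algebra_mult_closed:
  assumes "g \<notin> carrier G"
  shows "(a \<otimes>\<^bsub>group_algebra G\<^esub> b) g = 0"
proof -
  have "\<And>x y. x \<in> carrier G \<Longrightarrow> y \<in> carrier G \<Longrightarrow> x \<otimes> y \<noteq> g"
    using assms by auto
  then show ?thesis
    by (simp add: group_algebra_mult)
qed

text \<open>\<open>F\<close> gives the values of a linear functional on the group elements, and the
  sum evaluates this functional on a product. Associativity of the algebra and the product law of
  permutation modules are both obtained by a suitable choice of \<open>F\<close>.\<close>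

lemma (in monoid) sum_group_algebra_mult:
  assumes fin: "finite (carrier G)"
  shows "(\<Sum>g\<in>carrier G. (a \<otimes>\<^bsub>group_algebra G\<^esub> b) g * F g) =
    (\<Sum>x\<in>carrier G. \<Sum>y\<in>carrier G. a x * b y * F (x \<otimes> y))"
proof -
  have "(\<Sum>g\<in>carrier G. (a \<otimes>\<^bsub>group_algebra G\<^esub> b) g * F g) =
      (\<Sum>g\<in>carrier G. \<Sum>x\<in>carrier G. \<Sum>y\<in>carrier G. if x \<otimes> y = g then a x * b y * F g else 0)"
    by (auto simp: group_algebra_mult sum_distrib_right intro!: sum.cong)
  also have "\<dots> = (\<Sum>x\<in>carrier G. \<Sum>g\<in>carrier G. \<Sum>y\<in>carrier G. if x \<otimes> y = g then a x * b y * F g else 0)"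
    by (rule sum.swap)
  also have "\<dots> = (\<Sum>x\<in>carrier G. \<Sum>y\<in>carrier G. \<Sum>g\<in>carrier G. if x \<otimes> y = g then a x * b y * F g else 0)"
    by (rule sum.cong[OF refl], rule sum.swap)
  also have "\<dots> = (\<Sum>x\<in>carrier G. \<Sum>y\<in>carrier G. a x * b y * F (x \<otimes> y))"
    using fin by (auto intro!: sum.cong simp: sum.delta')
  finally show ?thesis .
qed

lemma (in group) group_algebra_ring:
  assumes fin: "finite (carrier G)"
  shows "ring (group_algebra G)"
proof (rule ringI)
  let ?A = "group_algebra G"
  show "abelian_group ?A"
  proof (rule abelian_groupI)
    fix x assume "x \<in> carrier ?A"
    then show "\<exists>y\<in>carrier ?A. y \<oplus>\<^bsub>?A\<^esub> x = \<zero>\<^bsub>?A\<^esub>"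
      by (intro bexI[of _ "\<lambda>g. - x g"]) auto
  qed (auto simp: algebra_simps)
  have assoc: "a \<otimes>\<^bsub>?A\<^esub> b \<otimes>\<^bsub>?A\<^esub> c = a \<otimes>\<^bsub>?A\<^esub> (b \<otimes>\<^bsub>?A\<^esub> c)" for a b c
  proof
    fix g
    \<comment> \<open>\<open>F w\<close> is the coefficient of \<open>g\<close> in the product of
      \<open>w\<close> with \<open>c\<close>, and \<open>F' x w\<close> tests whether the product of
      \<open>x\<close> and \<open>w\<close> is \<open>g\<close>. Both bracketings become the sum of
      a x * b y * c z over all triples with product \<open>g\<close>.\<close>
    define F where "F w = (\<Sum>z\<in>carrier G. c z * (if w \<otimes> z = g then 1 else 0))" for w
    define F' where "F' x w = (if x \<otimes> w = g then 1 else 0 :: complex)" for x w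
    have "(a \<otimes>\<^bsub>?A\<^esub> b \<otimes>\<^bsub>?A\<^esub> c) g = (\<Sum>w\<in>carrier G. (a \<otimes>\<^bsub>?A\<^esub> b) w * F w)"
      by (subst group_algebra_mult) (auto simp: F_def sum_distrib_left intro!: sum.cong)
    also have "\<dots> = (\<Sum>x\<in>carrier G. \<Sum>y\<in>carrier G. a x * b y * F (x \<otimes> y))"
      by (rule sum_group_algebra_mult[OF fin])
    also have "\<dots> = (\<Sum>x\<in>carrier G. a x * (\<Sum>y\<in>carrier G. \<Sum>z\<in>carrier G. b y * c z * F' x (y \<otimes> z)))"
      by (auto simp: F_def F'_def sum_distrib_left m_assoc intro!: sum.cong)
    also have "\<dots> = (\<Sum>x\<in>carrier G. a x * (\<Sum>w\<in>carrier G. (b \<otimes>\<^bsub>?A\<^esub> c) w * F' x w))"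
      by (simp only: sum_group_algebra_mult[OF fin])
    also have "\<dots> = (a \<otimes>\<^bsub>?A\<^esub> (b \<otimes>\<^bsub>?A\<^esub> c)) g"
      by (subst group_algebra_mult) (auto simp: F'_def sum_distrib_left intro!: sum.cong)
    finally show "(a \<otimes>\<^bsub>?A\<^esub> b \<otimes>\<^bsub>?A\<^esub> c) g = (a \<otimes>\<^bsub>?A\<^esub> (b \<otimes>\<^bsub>?A\<^esub> c)) g" .
  qed
  have one_left: "\<one>\<^bsub>?A\<^esub> \<otimes>\<^bsub>?A\<^esub> a = a" if "a \<in> carrier ?A" for a
  proof
    fix g
    have "(\<one>\<^bsub>?A\<^esub> \<otimes>\<^bsub>?A\<^esub> a) g =
        (\<Sum>x\<in>carrier G. if x = \<one> then (\<Sum>y\<in>carrier G. if y = g then a y else 0) else 0)"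
      by (auto simp: group_algebra_mult intro!: sum.cong sum.neutral)
    then show "(\<one>\<^bsub>?A\<^esub> \<otimes>\<^bsub>?A\<^esub> a) g = a g"
      using that fin by (auto simp: sum.delta)
  qed
  have one_right: "a \<otimes>\<^bsub>?A\<^esub> \<one>\<^bsub>?A\<^esub> = a" if "a \<in> carrier ?A" for a
  proof
    fix g
    have "(a \<otimes>\<^bsub>?A\<^esub> \<one>\<^bsub>?A\<^esub>) g =
        (\<Sum>x\<in>carrier G. \<Sum>y\<in>carrier G. if y = \<one> then (if x = g then a x else 0) else 0)"
      by (auto simp: group_algebra_mult intro!: sum.cong)
    then show "(a \<otimes>\<^bsub>?A\<^esub> \<one>\<^bsub>?A\<^esub>) g = a g"
      using that fin by (auto simp: sum.delta)
  qed
  show "monoid ?A"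
    by (rule monoidI) (use assoc one_left one_right group_algebra_mult_closed in auto)
  fix a b c
  show "(a \<oplus>\<^bsub>?A\<^esub> b) \<otimes>\<^bsub>?A\<^esub> c = a \<otimes>\<^bsub>?A\<^esub> c \<oplus>\<^bsub>?A\<^esub> b \<otimes>\<^bsub>?A\<^esub> c"
    by (auto simp: group_algebra_mult fun_eq_iff algebra_simps simp flip: sum.distrib intro!: sum.cong)
  show "c \<otimes>\<^bsub>?A\<^esub> (a \<oplus>\<^bsub>?A\<^esub> b) = c \<otimes>\<^bsub>?A\<^esub> a \<oplus>\<^bsub>?A\<^esub> c \<otimes>\<^bsub>?A\<^esub> b"
    by (auto simp: group_algebra_mult fun_eq_iff algebra_simps simp flip: sum.distrib intro!: sum.cong)
qed

lemma group_elem_in_group_algebra: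
  "g \<in> carrier G \<Longrightarrow> group_elem g \<in> carrier (group_algebra G)"
  by (auto simp: group_elem_def)

lemma sum_group_elem_mult:
  assumes "finite A" "g \<in> A"
  shows "(\<Sum>x\<in>A. group_elem g x * F x) = F g"
proof -
  have "(\<Sum>x\<in>A. group_elem g x * F x) = (\<Sum>x\<in>A. if x = g then F x else 0)"
    by (rule sum.cong) (auto simp: group_elem_def)
  with assms show ?thesis by simp
qed

text \<open>Coefficient functions from the smaller algebra vanish outside \<open>H\<close>, so the
  additional summands over \<open>G\<close> are all zero.\<close>

lemma group_algebra_mult_submonoid:
  assumes "carrier H \<subseteq> carrier G" "monoid.mult H = monoid.mult G" "finite (carrier G)"
    and "a \<in> carrier (group_algebra H)" "b \<in> carrier (group_algebra H)"
  shows "a \<otimes>\<^bsub>group_algebra G\<^esub> b = a \<otimes>\<^bsub>group_algebra H\<^esub> b"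
proof
  fix g
  have "(\<Sum>y\<in>carrier G. if x \<otimes>\<^bsub>G\<^esub> y = g then a x * b y else 0) =
      (\<Sum>y\<in>carrier H. if x \<otimes>\<^bsub>G\<^esub> y = g then a x * b y else 0)" for x
    using assms by (intro sum.mono_neutral_right) auto
  then have "(a \<otimes>\<^bsub>group_algebra G\<^esub> b) g =
      (\<Sum>x\<in>carrier G. \<Sum>y\<in>carrier H. if x \<otimes>\<^bsub>G\<^esub> y = g then a x * b y else 0)"
    by (simp add: group_algebra_mult)
  also have "\<dots> = (\<Sum>x\<in>carrier H. \<Sum>y\<in>carrier H. if x \<otimes>\<^bsub>G\<^esub> y = g then a x * b y else 0)"
    using assms by (intro sum.mono_neutral_right) (auto intro!: sum.neutral)
  finally show "(a \<otimes>\<^bsub>group_algebra G\<^esub> b) g = (a \<otimes>\<^bsub>group_algebra H\<^esub> b) g"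
    using assms by (simp add: group_algebra_mult)
qed

lemma right_module_restrict:
  assumes M: "right_module (group_algebra G) M"
    and H: "group H" "carrier H \<subseteq> carrier G" "monoid.mult H = monoid.mult G"
      "\<one>\<^bsub>H\<^esub> = \<one>\<^bsub>G\<^esub>" and fin: "finite (carrier G)"
  shows "right_module (group_algebra H) M"
proof -
  interpret M: right_module "group_algebra G" M by (rule M)
  interpret H: group H by (rule H)
  interpret RH: ring "group_algebra H"
    using H.group_algebra_ring H fin finite_subset by blast
  have sub: "a \<in> carrier (group_algebra G)" if "a \<in> carrier (group_algebra H)" for a
    using that H by auto
  note m = group_algebra_mult_submonoid[OF H(2,3) fin]
  show ?thesis
  proof (unfold_locales, goal_cases)
    case 1 then show ?case using M.act_closed sub by blast
  next
    case (2 a b x) then show ?case using M.act_add_scalar[OF sub sub] by simp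
  next
    case 3 then show ?case using M.act_add sub by blast
  next
    case (4 a b x) then show ?case using M.act_mult[OF sub sub, of a b x] m[of a b] by simp
  next
    case 5 then show ?case using M.act_one H by simp
  qed
qed

text \<open>The module laws of \<open>N\<close> are transported along \<open>h\<close> instead of
  being assumed, which spares a direct proof of them for the tensor product. The condition on zero
  fixes the field \<open>ring.zero\<close> of \<open>N\<close>, about which nothing is known before
  \<open>N\<close> is seen to be a group.\<close>

lemma right_module_isomorphicI:
  fixes M :: "('a, 'b, 'm) module_scheme" and N :: "('a, 'c, 'k) module_scheme"
  assumes M: "right_module R M"
    and bij: "bij_betw h (carrier M) (carrier N)"
    and zero: "h \<zero>\<^bsub>M\<^esub> = \<zero>\<^bsub>N\<^esub>"
    and add: "\<And>x y. x \<in> carrier M \<Longrightarrow> y \<in> carrier M \<Longrightarrow> h (x \<oplus>\<^bsub>M\<^esub> y) = h x \<oplus>\<^bsub>N\<^esub> h y"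
    and act: "\<And>a x. a \<in> carrier R \<Longrightarrow> x \<in> carrier M \<Longrightarrow> h (a \<odot>\<^bsub>M\<^esub> x) = a \<odot>\<^bsub>N\<^esub> h x"
  shows "right_module_isomorphic R M N"
proof -
  interpret M: right_module R M by (rule M)
  have img: "carrier N = h ` carrier M"
    using bij by (simp add: bij_betw_def)
  have "abelian_group N"
  proof (rule abelian_groupI)
    fix x assume "x \<in> carrier N"
    then obtain u where "u \<in> carrier M" "x = h u" using img by auto
    then show "\<exists>y\<in>carrier N. y \<oplus>\<^bsub>N\<^esub> x = \<zero>\<^bsub>N\<^esub>"
      by (intro bexI[of _ "h (\<ominus>\<^bsub>M\<^esub> u)"])
        (auto simp: img M.l_neg simp flip: add zero)
  qed (auto simp: img M.a_ac simp flip: add zero)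
  then interpret N: abelian_group N .
  have "right_module R N"
    by unfold_locales
      (auto simp: img M.act_closed M.act_add_scalar M.act_add M.act_mult M.act_one
        simp flip: add act)
  then show ?thesis
    unfolding right_module_isomorphic_def using assms by blast
qed

section \<open>Permutation modules\<close>

text \<open>The record \<open>M\<close> is a parameter, constrained only through its fields, so that
  \<open>CV_module\<close> itself can be an instance. With the inverse in \<open>smult_M\<close>,
  the point mass at \<open>v\<close> is sent by \<open>g\<close> to the point mass at
  \<open>act v g\<close>.\<close>

locale permutation_module = group G for G :: "'g monoid" (structure) +
  fixes \<Omega> :: "'v set" and act :: "'v \<Rightarrow> 'g \<Rightarrow> 'v"
    and M :: "('g \<Rightarrow> complex, 'v \<Rightarrow> complex, 'm) module_scheme"
  assumes finite_G: "finite (carrier G)"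
    and act_in: "v \<in> \<Omega> \<Longrightarrow> g \<in> carrier G \<Longrightarrow> act v g \<in> \<Omega>"
    and act_unit: "v \<in> \<Omega> \<Longrightarrow> act v \<one> = v"
    and act_comp: "v \<in> \<Omega> \<Longrightarrow> g \<in> carrier G \<Longrightarrow> h \<in> carrier G \<Longrightarrow> act (act v g) h = act v (g \<otimes> h)"
    and carrier_M: "carrier M = {\<tau>. \<forall>v. v \<notin> \<Omega> \<longrightarrow> \<tau> v = 0}"
    and zero_M: "\<zero>\<^bsub>M\<^esub> = (\<lambda>v. 0)"
    and add_M: "\<sigma> \<oplus>\<^bsub>M\<^esub> \<tau> = (\<lambda>v. \<sigma> v + \<tau> v)"
    and smult_M: "a \<odot>\<^bsub>M\<^esub> \<tau> = (\<lambda>v. if v \<in> \<Omega> then \<Sum>g\<in>carrier G. a g * \<tau> (act v (inv g)) else 0)"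
begin

lemma right_module: "right_module (group_algebra G) M"
proof -
  interpret R: ring "group_algebra G"
    by (rule group_algebra_ring[OF finite_G])
  interpret M: abelian_group M
  proof (rule abelian_groupI)
    fix x assume "x \<in> carrier M"
    then show "\<exists>y\<in>carrier M. y \<oplus>\<^bsub>M\<^esub> x = \<zero>\<^bsub>M\<^esub>"
      by (intro bexI[of _ "\<lambda>g. - x g"]) (auto simp: carrier_M zero_M add_M)
  qed (auto simp: carrier_M zero_M add_M algebra_simps)
  show ?thesis
  proof (unfold_locales, goal_cases)
    case (4 a b \<tau>)
    show ?case
    proof
      fix v
      have "((a \<otimes>\<^bsub>group_algebra G\<^esub> b) \<odot>\<^bsub>M\<^esub> \<tau>) v = (b \<odot>\<^bsub>M\<^esub> (a \<odot>\<^bsub>M\<^esub> \<tau>)) v" if v: "v \<in> \<Omega>"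
      proof -
        have "((a \<otimes>\<^bsub>group_algebra G\<^esub> b) \<odot>\<^bsub>M\<^esub> \<tau>) v =
            (\<Sum>x\<in>carrier G. \<Sum>y\<in>carrier G. a x * b y * \<tau> (act v (inv (x \<otimes> y))))"
          using v by (simp add: smult_M sum_group_algebra_mult[OF finite_G, of a b "\<lambda>g. \<tau> (act v (inv g))"])
        also have "\<dots> = (\<Sum>y\<in>carrier G. \<Sum>x\<in>carrier G. a x * b y * \<tau> (act v (inv (x \<otimes> y))))"
          by (rule sum.swap)
        \<comment> \<open>\<open>inv (x \<otimes> y)\<close> is
          \<open>inv y \<otimes> inv x\<close>, and a right action applies \<open>inv y\<close>
          before \<open>inv x\<close>. Hence \<open>b\<close> becomes the outer scalar, as the
          associative law of right modules demands.\<close>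
        also have "\<dots> = (b \<odot>\<^bsub>M\<^esub> (a \<odot>\<^bsub>M\<^esub> \<tau>)) v"
          using v by (auto simp: smult_M act_in act_comp inv_mult_group sum_distrib_left algebra_simps intro!: sum.cong)
        finally show ?thesis .
      qed
      then show "((a \<otimes>\<^bsub>group_algebra G\<^esub> b) \<odot>\<^bsub>M\<^esub> \<tau>) v = (b \<odot>\<^bsub>M\<^esub> (a \<odot>\<^bsub>M\<^esub> \<tau>)) v"
        by (auto simp: smult_M)
    qed
  next
    case (5 \<tau>)
    have "(\<Sum>g\<in>carrier G. (if g = \<one> then 1 else 0) * \<tau> (act v (inv g))) =
        (\<Sum>g\<in>carrier G. if g = \<one> then \<tau> (act v (inv g)) else 0)" for v
      by (rule sum.cong) auto
    then show ?case
      using 5 finite_G by (auto simp: smult_M carrier_M act_unit sum.delta)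
  qed (auto simp: smult_M add_M carrier_M algebra_simps fun_eq_iff simp flip: sum.distrib)
qed

lemma group_elem_act:
  assumes "g \<in> carrier G" "v \<in> \<Omega>"
  shows "(group_elem g \<odot>\<^bsub>M\<^esub> \<tau>) v = \<tau> (act v (inv g))"
  using assms by (simp add: smult_M sum_group_elem_mult finite_G)

lemma act_inv_eq_iff:
  assumes "g \<in> carrier G" "v \<in> \<Omega>" "w \<in> \<Omega>"
  shows "act v (inv g) = w \<longleftrightarrow> act w g = v"
  using assms act_comp[of v "inv g" g] act_comp[of w g "inv g"] act_unit
  by auto

text \<open>The translates of the point mass at \<open>v0\<close> are the point masses on its orbit;
  the coefficient at \<open>v\<close> collects all \<open>g\<close> that carry \<open>v0\<close> to
  \<open>v\<close>.\<close>

lemma act_group_elem: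
  assumes "v0 \<in> \<Omega>" "v \<in> \<Omega>"
  shows "(s \<odot>\<^bsub>M\<^esub> group_elem v0) v = (\<Sum>g\<in>carrier G. if act v0 g = v then s g else 0)"
  using assms by (auto simp: smult_M group_elem_def act_inv_eq_iff intro!: sum.cong)

text \<open>Functions on the set are pulled back to \<open>H\<close> along the orbit map
  \<open>act v0\<close>. The action of \<open>a\<close> then sums a y * \<tau> (act v0 (g y')) over
  \<open>y\<close>, with y' the inverse of \<open>y\<close>, and this is the convolution product at
  \<open>g\<close>.\<close>

lemma regular:
  assumes H: "group H" "carrier H \<subseteq> carrier G" "monoid.mult H = monoid.mult G" "\<one>\<^bsub>H\<^esub> = \<one>"
    and v0: "v0 \<in> \<Omega>" and bij: "bij_betw (act v0) (carrier H) \<Omega>"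
  shows "right_module_isomorphic (group_algebra H) M (regular_right_module (group_algebra H))"
proof (rule right_module_isomorphicI)
  interpret H: group H by (rule H)
  show "right_module (group_algebra H) M"
    using right_module_restrict[OF right_module H finite_G] .
  define e where "e = inv_into (carrier H) (act v0)"
  have e: "e v \<in> carrier H" "act v0 (e v) = v" if "v \<in> \<Omega>" for v
    using that bij unfolding e_def bij_betw_def by (auto simp: inv_into_into f_inv_into_f)
  have e': "e (act v0 g) = g" if "g \<in> carrier H" for g
    using that bij unfolding e_def bij_betw_def by auto
  have in_Om: "act v0 g \<in> \<Omega>" if "g \<in> carrier H" for g
    using that bij by (auto simp: bij_betw_def)
  let ?h = "\<lambda>\<tau> g. if g \<in> carrier H then \<tau> (act v0 g) else (0 :: complex)"
  show "bij_betw ?h (carrier M) (carrier (regular_right_module (group_algebra H)))"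
    by (rule bij_betw_byWitness[where f' = "\<lambda>a v. if v \<in> \<Omega> then a (e v) else 0"])
      (auto simp: carrier_M regular_right_module_def fun_eq_iff e e' in_Om)
  show "?h \<zero>\<^bsub>M\<^esub> = \<zero>\<^bsub>regular_right_module (group_algebra H)\<^esub>"
    by (auto simp: zero_M regular_right_module_def)
  show "?h (x \<oplus>\<^bsub>M\<^esub> y) = ?h x \<oplus>\<^bsub>regular_right_module (group_algebra H)\<^esub> ?h y" for x y
    by (auto simp: add_M regular_right_module_def)
  fix a \<tau> assume a: "a \<in> carrier (group_algebra H)" and "\<tau> \<in> carrier M"
  have inv: "inv\<^bsub>G\<^esub> y = inv\<^bsub>H\<^esub> y" if "y \<in> carrier H" for y
    using that H H.l_inv[of y] H.inv_closed[of y] by (intro inv_equality) (auto simp del: H.l_inv)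
  have "(\<Sum>y\<in>carrier G. a y * \<tau> (act (act v0 g) (inv y))) = (?h \<tau> \<otimes>\<^bsub>group_algebra H\<^esub> a) g"
    if g: "g \<in> carrier H" for g
  proof -
    have "(\<Sum>y\<in>carrier G. a y * \<tau> (act (act v0 g) (inv y))) =
        (\<Sum>y\<in>carrier H. a y * \<tau> (act (act v0 g) (inv y)))"
      using a H finite_G by (intro sum.mono_neutral_right) auto
    \<comment> \<open>The value at \<open>g \<otimes> inv y\<close> is spread out as a sum over
      \<open>x\<close> with a single nonzero term, because the product in the group algebra is a
      double sum with the condition that the product of \<open>x\<close> and \<open>y\<close> is
      \<open>g\<close>.\<close>
    also have "\<dots> = (\<Sum>y\<in>carrier H. \<Sum>x\<in>carrier H. if x = g \<otimes>\<^bsub>H\<^esub> inv\<^bsub>H\<^esub> y then ?h \<tau> x * a y else 0)"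
    proof (rule sum.cong[OF refl])
      fix y assume y: "y \<in> carrier H"
      have "act (act v0 g) (inv y) = act v0 (g \<otimes>\<^bsub>H\<^esub> inv\<^bsub>H\<^esub> y)"
        using y g H v0 by (subst act_comp) (auto simp: inv)
      then show "a y * \<tau> (act (act v0 g) (inv y)) =
          (\<Sum>x\<in>carrier H. if x = g \<otimes>\<^bsub>H\<^esub> inv\<^bsub>H\<^esub> y then ?h \<tau> x * a y else 0)"
        using y g finite_subset[OF H(2) finite_G] by (simp add: sum.delta)
    qed
    also have "\<dots> = (\<Sum>y\<in>carrier H. \<Sum>x\<in>carrier H. if x \<otimes>\<^bsub>H\<^esub> y = g then ?h \<tau> x * a y else 0)"
      using g by (auto intro!: sum.cong simp: H.inv_solve_right)
    also have "\<dots> = (?h \<tau> \<otimes>\<^bsub>group_algebra H\<^esub> a) g"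
      unfolding group_algebra_mult by (rule sum.swap)
    finally show ?thesis .
  qed
  then show "?h (a \<odot>\<^bsub>M\<^esub> \<tau>) = a \<odot>\<^bsub>regular_right_module (group_algebra H)\<^esub> ?h \<tau>"
    using H.group_algebra_mult_closed in_Om
    by (auto simp: regular_right_module_def smult_M fun_eq_iff)
qed

end

lemma (in group) mult_fun_scale_group_elem:
  assumes "finite (carrier G)" "g \<in> carrier G" "h \<in> carrier G"
  shows "fun_scale c (group_elem g) \<otimes>\<^bsub>group_algebra G\<^esub> fun_scale d (group_elem h) =
    fun_scale (c * d) (group_elem (g \<otimes> h))"
proof
  fix k
  have "(fun_scale c (group_elem g) \<otimes>\<^bsub>group_algebra G\<^esub> fun_scale d (group_elem h)) k =
      (\<Sum>x\<in>carrier G. if x = g then \<Sum>y\<in>carrier G. if y = h then if g \<otimes> h = k then c * d else 0 else 0 else 0)"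
    unfolding group_algebra_mult
    by (rule sum.cong) (auto simp: fun_scale_def group_elem_def intro!: sum.cong sum.neutral)
  also have "\<dots> = fun_scale (c * d) (group_elem (g \<otimes> h)) k"
    using assms by (simp add: sum.delta fun_scale_def group_elem_def)
  finally show "(fun_scale c (group_elem g) \<otimes>\<^bsub>group_algebra G\<^esub> fun_scale d (group_elem h)) k =
    fun_scale (c * d) (group_elem (g \<otimes> h)) k" .
qed

section \<open>Transitive permutation modules are induced\<close>

lemma free_Abelian_group_r_coset:
  "N #>\<^bsub>free_Abelian_group S\<^esub> x = (\<lambda>n. n + x) ` N"
  by (auto simp: r_coset_def)

lemma free_Abelian_group_set_mult:
  "A <#>\<^bsub>free_Abelian_group S\<^esub> B = {a + b |a b. a \<in> A \<and> b \<in> B}"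
  by (auto simp: set_mult_def)

lemma free_Abelian_group_subgroup_closed:
  assumes "subgroup N (free_Abelian_group S)"
  shows "0 \<in> N" "x \<in> N \<Longrightarrow> y \<in> N \<Longrightarrow> x + y \<in> N" "x \<in> N \<Longrightarrow> - x \<in> N"
    "x \<in> N \<Longrightarrow> y \<in> N \<Longrightarrow> x - y \<in> N" "x \<in> N \<Longrightarrow> Poly_Mapping.keys x \<subseteq> S"
proof -
  show "0 \<in> N"
    using assms subgroup.one_closed by fastforce
  show add: "x + y \<in> N" if "x \<in> N" "y \<in> N" for x y
    using assms that subgroup.m_closed by fastforce
  show keys: "Poly_Mapping.keys x \<subseteq> S" if "x \<in> N" for x
    using assms that subgroup.subset by fastforce
  show minus: "- x \<in> N" if "x \<in> N" for x
    using assms that keys subgroup.m_inv_closed by fastforce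
  show "x - y \<in> N" if "x \<in> N" "y \<in> N" for x y
    using add[OF that(1) minus[OF that(2)]] by simp
qed

lemma free_Abelian_group_r_coset_eq_iff:
  assumes "subgroup N (free_Abelian_group S)"
  shows "N #>\<^bsub>free_Abelian_group S\<^esub> x = N #>\<^bsub>free_Abelian_group S\<^esub> y \<longleftrightarrow> x - y \<in> N"
proof
  note N = free_Abelian_group_subgroup_closed[OF assms]
  assume "N #>\<^bsub>free_Abelian_group S\<^esub> x = N #>\<^bsub>free_Abelian_group S\<^esub> y"
  moreover have "x \<in> (\<lambda>n. n + x) ` N"
    using N(1) by force
  ultimately show "x - y \<in> N"
    by (auto simp: free_Abelian_group_r_coset)
next
  note N = free_Abelian_group_subgroup_closed[OF assms]
  assume xy: "x - y \<in> N"
  have "n + x \<in> (\<lambda>n. n + y) ` N" if "n \<in> N" for n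
    by (rule image_eqI[of _ _ "n + (x - y)"]) (use N(2) that xy in auto)
  moreover have "n + y \<in> (\<lambda>n. n + x) ` N" if "n \<in> N" for n
    by (rule image_eqI[of _ _ "n - (x - y)"]) (use N(4) that xy in auto)
  ultimately show "N #>\<^bsub>free_Abelian_group S\<^esub> x = N #>\<^bsub>free_Abelian_group S\<^esub> y"
    by (auto simp: free_Abelian_group_r_coset)
qed

section \<open>Relations of the tensor product\<close>

context
  fixes R :: "('a, 'r) ring_scheme" and S :: "('a, 's) ring_scheme"
    and M :: "('a, 'b, 'm) module_scheme"
begin

lemma tensor_relations_carrier:
  assumes "ring S" "carrier R \<subseteq> carrier S"
    and "\<And>m m'. m \<in> carrier M \<Longrightarrow> m' \<in> carrier M \<Longrightarrow> m \<oplus>\<^bsub>M\<^esub> m' \<in> carrier M"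
    and "\<And>r m. r \<in> carrier R \<Longrightarrow> m \<in> carrier M \<Longrightarrow> r \<odot>\<^bsub>M\<^esub> m \<in> carrier M"
  shows "tensor_relations R S M \<subseteq> carrier (free_Abelian_group (carrier M \<times> carrier S))"
proof -
  interpret S: ring S by fact
  have diff: "Poly_Mapping.keys x \<subseteq> A \<Longrightarrow> Poly_Mapping.keys y \<subseteq> A \<Longrightarrow> Poly_Mapping.keys (x - y) \<subseteq> A"
    for x y :: "'b \<times> 'a \<Rightarrow>\<^sub>0 int" and A
    using keys_diff[of x y] by blast
  show ?thesis
    unfolding tensor_relations_def
    by (intro Un_least; clarify; unfold carrier_free_Abelian_group_iff; intro diff)
      (use assms(2-4) in auto)
qed

text \<open>Right multiplication by \<open>a\<close> turns each of the three kinds of relation into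
  one of the same kind, by distributivity and by (r s) a = r (s a). The right action on the tensor
  product is well defined for this reason.\<close>

lemma frag_extend_tensor_relations:
  assumes "ring S" "carrier R \<subseteq> carrier S" "a \<in> carrier S" "x \<in> tensor_relations R S M"
  shows "frag_extend (\<lambda>(m, s). frag_of (m, s \<otimes>\<^bsub>S\<^esub> a)) x \<in> tensor_relations R S M"
proof -
  interpret S: ring S by fact
  from assms(4) consider
      (1) m m' s where "x = frag_of (m \<oplus>\<^bsub>M\<^esub> m', s) - frag_of (m, s) - frag_of (m', s)"
        "m \<in> carrier M" "m' \<in> carrier M" "s \<in> carrier S"
    | (2) m s s' where "x = frag_of (m, s \<oplus>\<^bsub>S\<^esub> s') - frag_of (m, s) - frag_of (m, s')"
        "m \<in> carrier M" "s \<in> carrier S" "s' \<in> carrier S"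
    | (3) m r s where "x = frag_of (r \<odot>\<^bsub>M\<^esub> m, s) - frag_of (m, r \<otimes>\<^bsub>S\<^esub> s)"
        "m \<in> carrier M" "r \<in> carrier R" "s \<in> carrier S"
    unfolding tensor_relations_def by blast
  then show ?thesis
  proof cases
    case 1
    then have "frag_extend (\<lambda>(m, s). frag_of (m, s \<otimes>\<^bsub>S\<^esub> a)) x =
        frag_of (m \<oplus>\<^bsub>M\<^esub> m', s \<otimes>\<^bsub>S\<^esub> a) - frag_of (m, s \<otimes>\<^bsub>S\<^esub> a) - frag_of (m', s \<otimes>\<^bsub>S\<^esub> a)"
      by (simp add: frag_extend_diff)
    with 1 assms show ?thesis
      unfolding tensor_relations_def by blast
  next
    case 2
    then have "frag_extend (\<lambda>(m, s). frag_of (m, s \<otimes>\<^bsub>S\<^esub> a)) x =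
        frag_of (m, s \<otimes>\<^bsub>S\<^esub> a \<oplus>\<^bsub>S\<^esub> s' \<otimes>\<^bsub>S\<^esub> a) - frag_of (m, s \<otimes>\<^bsub>S\<^esub> a) - frag_of (m, s' \<otimes>\<^bsub>S\<^esub> a)"
      using assms by (simp add: frag_extend_diff S.l_distr)
    with 2 assms show ?thesis
      unfolding tensor_relations_def by blast
  next
    case 3
    then have "frag_extend (\<lambda>(m, s). frag_of (m, s \<otimes>\<^bsub>S\<^esub> a)) x =
        frag_of (r \<odot>\<^bsub>M\<^esub> m, s \<otimes>\<^bsub>S\<^esub> a) - frag_of (m, r \<otimes>\<^bsub>S\<^esub> (s \<otimes>\<^bsub>S\<^esub> a))"
      using assms by (auto simp add: frag_extend_diff S.m_assoc)
    with 3 assms show ?thesis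
      unfolding tensor_relations_def by blast
  qed
qed

end

context permutation_module
begin

text \<open>The stabilizer \<open>H\<close> fixes \<open>v0\<close>, so z \<otimes> s \<mapsto> z
  (v0 s) respects the relations over the algebra of \<open>H\<close>. Its inverse comes from a
  normal form: modulo the relations every element is 1 \<otimes> \<open>\<sigma> \<tau>\<close> for
  some \<open>\<tau>\<close>. No dimensions are compared.\<close>

lemma induced:
  fixes H :: "'g monoid"
  assumes v0: "v0 \<in> \<Omega>" and transitive: "\<And>v. v \<in> \<Omega> \<Longrightarrow> \<exists>g\<in>carrier G. act v0 g = v"
    and H: "carrier H = {g \<in> carrier G. act v0 g = v0}" "monoid.mult H = monoid.mult G"
      "\<one>\<^bsub>H\<^esub> = \<one>"
  shows "right_module_isomorphic (group_algebra G) M (induced_module H G (trivial_module H))"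
proof -
  interpret S: ring "group_algebra G"
    by (rule group_algebra_ring[OF finite_G])
  interpret M: right_module "group_algebra G" M
    by (rule right_module)
  let ?S = "group_algebra G" and ?R = "group_algebra H" and ?C = "trivial_module H"
  define F where "F = free_Abelian_group ((UNIV :: complex set) \<times> carrier ?S)"
  define N where "N = generate F (tensor_relations ?R ?S ?C)"
  have C: "carrier ?C = UNIV" "\<And>x y. x \<oplus>\<^bsub>?C\<^esub> y = x + y"
      "\<And>a z. a \<odot>\<^bsub>?C\<^esub> z = z * (\<Sum>g\<in>carrier H. a g)"
    by (simp_all add: trivial_module_def)
  have HG: "carrier H \<subseteq> carrier G"
    using H by auto
  have RS: "carrier ?R \<subseteq> carrier ?S"
    using HG by auto
  have finH: "finite (carrier H)"
    using HG finite_G finite_subset by blast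
  interpret F: group F
    unfolding F_def by simp
  have rel: "tensor_relations ?R ?S ?C \<subseteq> carrier F"
    using tensor_relations_carrier[of ?S ?R ?C] S.ring_axioms RS by (simp add: F_def C(1))
  have N_sub: "subgroup N F"
    unfolding N_def by (rule F.generate_is_subgroup[OF rel])
  note N = free_Abelian_group_subgroup_closed[OF N_sub[unfolded F_def]]
  note coset_eq = free_Abelian_group_r_coset_eq_iff[OF N_sub[unfolded F_def], folded F_def]
  have N_trans: "x - z \<in> N" if "x - y \<in> N" "y - z \<in> N" for x y z
    using N(2)[OF that] by simp
  have N_sym: "y - x \<in> N" if "x - y \<in> N" for x y
    using N(3)[OF that] by simp
  have N_rel: "x \<in> N" if "x \<in> tensor_relations ?R ?S ?C" for x
    using that unfolding N_def by (rule generate.incl)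
  have N_right: "frag_of (z, s \<oplus>\<^bsub>?S\<^esub> s') - frag_of (z, s) - frag_of (z, s') \<in> N"
    if "s \<in> carrier ?S" "s' \<in> carrier ?S" for z s s'
    using that by (intro N_rel) (unfold tensor_relations_def C, blast)
  have N_mid: "frag_of (z * (\<Sum>g\<in>carrier H. r g), s) - frag_of (z, r \<otimes>\<^bsub>?S\<^esub> s) \<in> N"
    if "r \<in> carrier ?R" "s \<in> carrier ?S" for z r s
    using that by (intro N_rel) (unfold tensor_relations_def C, blast)
  \<comment> \<open>Additivity in the second factor, taken for 0 + 0 = 0, is the relation stating
    that minus this generator lies in \<open>N\<close>.\<close>
  have N_zero: "frag_of (z, \<lambda>g. 0) \<in> N" for z
    using N(3)[OF N_right[of "\<lambda>g. 0" "\<lambda>g. 0" z]] by simp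

  text \<open>The isomorphism sends \<open>z \<otimes> s\<close> to \<open>z (v0 s)\<close>; a section of it is obtained from a
    choice of coset representatives \<open>t v\<close>.\<close>
  define \<Phi> where "\<Phi> = (\<lambda>(z, s). fun_scale z (s \<odot>\<^bsub>M\<^esub> group_elem v0))"
  define t where "t v = (SOME g. g \<in> carrier G \<and> act v0 g = v)" for v
  define \<sigma> where "\<sigma> \<tau> = (\<lambda>g. if g \<in> carrier G \<and> g = t (act v0 g) then \<tau> (act v0 g) else (0::complex))" for \<tau>
  have t: "t v \<in> carrier G" "act v0 (t v) = v" if "v \<in> \<Omega>" for v
    using someI_ex[of "\<lambda>g. g \<in> carrier G \<and> act v0 g = v"] transitive[OF that] unfolding t_def by auto
  have \<sigma>_carrier: "\<sigma> \<tau> \<in> carrier ?S" for \<tau>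
    by (simp add: \<sigma>_def)
  have \<sigma>_add: "\<sigma> (\<lambda>v. \<tau> v + \<tau>' v) = \<sigma> \<tau> \<oplus>\<^bsub>?S\<^esub> \<sigma> \<tau>'" for \<tau> \<tau>'
    by (auto simp: \<sigma>_def)
  have elem_v0: "group_elem v0 \<in> carrier M"
    using v0 by (auto simp: carrier_M group_elem_def)
  have \<Phi>_carrier: "\<Phi> (z, s) \<in> carrier M" for z s
    by (auto simp: \<Phi>_def fun_scale_def carrier_M smult_M)
  have \<Phi>_apply: "\<Phi> (z, s) v = z * (\<Sum>g\<in>carrier G. if act v0 g = v then s g else 0)"
    if "v \<in> \<Omega>" for z s v
    using that v0 by (simp add: \<Phi>_def fun_scale_def act_group_elem)
  have \<Phi>_eqI: "\<Phi> (z, s) = \<tau>"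
    if "\<tau> \<in> carrier M" "\<And>v. v \<in> \<Omega> \<Longrightarrow> \<Phi> (z, s) v = \<tau> v" for z s \<tau>
    using that \<Phi>_carrier[of z s] by (simp add: carrier_M fun_eq_iff) metis
  have \<Phi>_\<sigma>: "\<Phi> (1, \<sigma> \<tau>) = \<tau>" if \<tau>: "\<tau> \<in> carrier M" for \<tau>
  proof (rule \<Phi>_eqI[OF \<tau>])
    fix v assume v: "v \<in> \<Omega>"
    \<comment> \<open>Among all \<open>g\<close> carrying \<open>v0\<close> to \<open>v\<close>,
      only the representative \<open>t v\<close> has a nonzero coefficient in
      \<open>\<sigma> \<tau>\<close>, unless \<open>\<tau> v\<close> is itself zero.\<close>
    have "(\<Sum>g\<in>carrier G. if act v0 g = v then \<sigma> \<tau> g else 0) =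
        (\<Sum>g\<in>carrier G. if g = t v then \<tau> v else 0)"
      using t[OF v] by (intro sum.cong) (auto simp: \<sigma>_def)
    with v t[OF v] finite_G show "\<Phi> (1, \<sigma> \<tau>) v = \<tau> v"
      by (simp add: \<Phi>_apply)
  qed
  have \<Phi>_add: "\<Phi> (z, s \<oplus>\<^bsub>?S\<^esub> s') = \<Phi> (z, s) \<oplus>\<^bsub>M\<^esub> \<Phi> (z, s')"
    if "s \<in> carrier ?S" "s' \<in> carrier ?S" for z s s'
    unfolding \<Phi>_def
    by (simp only: prod.case M.act_add_scalar[OF that elem_v0])
      (auto simp: add_M fun_scale_def algebra_simps)
  \<comment> \<open>\<open>r\<close> lives on \<open>H\<close>, and every element of
    \<open>H\<close> fixes \<open>v0\<close>. So \<open>r\<close> acts on the point mass through the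
    sum of its coefficients, which is exactly its action on the trivial module.\<close>
  have stab: "r \<odot>\<^bsub>M\<^esub> group_elem v0 = fun_scale (\<Sum>g\<in>carrier H. r g) (group_elem v0)"
    if r: "r \<in> carrier ?R" for r
  proof
    fix v
    have "(r \<odot>\<^bsub>M\<^esub> group_elem v0) v = (\<Sum>g\<in>carrier G. if act v0 g = v then r g else 0)" if "v \<in> \<Omega>"
      using that v0 by (simp add: act_group_elem)
    also have "(\<Sum>g\<in>carrier G. if act v0 g = v then r g else 0) =
        (\<Sum>g\<in>carrier H. if act v0 g = v then r g else 0)"
      using r HG finite_G by (intro sum.mono_neutral_right) auto
    also have "\<dots> = (if v = v0 then \<Sum>g\<in>carrier H. r g else 0)"
      using H by (auto intro!: sum.cong sum.neutral)
    finally show "(r \<odot>\<^bsub>M\<^esub> group_elem v0) v = fun_scale (\<Sum>g\<in>carrier H. r g) (group_elem v0) v"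
      using v0 by (cases "v \<in> \<Omega>") (auto simp: smult_M fun_scale_def group_elem_def)
  qed
  have act_scale: "s \<odot>\<^bsub>M\<^esub> fun_scale c \<tau> = fun_scale c (s \<odot>\<^bsub>M\<^esub> \<tau>)" for s c \<tau>
    by (auto simp: smult_M fun_scale_def sum_distrib_left algebra_simps fun_eq_iff intro!: sum.cong)
  have \<Phi>_mid: "\<Phi> (z * (\<Sum>g\<in>carrier H. r g), s) = \<Phi> (z, r \<otimes>\<^bsub>?S\<^esub> s)"
    if "r \<in> carrier ?R" "s \<in> carrier ?S" for z r s
    unfolding \<Phi>_def prod.case M.act_mult[OF subsetD[OF RS that(1)] that(2) elem_v0] stab[OF that(1)] act_scale
    by (simp add: fun_scale_def mult.assoc)

  obtain \<phi> where \<phi>: "\<phi> \<in> hom F (add_monoid M)" and \<phi>_of: "\<And>z s. s \<in> carrier ?S \<Longrightarrow> \<phi> (frag_of (z, s)) = \<Phi> (z, s)"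
  proof (rule comm_group.free_Abelian_group_universal[OF M.a_comm_group])
    show "\<Phi> ` (UNIV \<times> carrier ?S) \<subseteq> carrier (add_monoid M)"
      using \<Phi>_carrier by auto
    fix \<phi> assume \<phi>: "\<phi> \<in> hom (free_Abelian_group (UNIV \<times> carrier ?S)) (add_monoid M)"
      "\<And>x. x \<in> UNIV \<times> carrier ?S \<Longrightarrow> \<phi> (frag_of x) = \<Phi> x"
    show thesis
      by (rule that[of \<phi>]) (use \<phi> in \<open>auto simp: F_def\<close>)
  qed
  interpret \<phi>: group_hom F "add_monoid M" \<phi>
    using \<phi> by unfold_locales
  have \<phi>_carrier: "\<phi> x \<in> carrier M" if "x \<in> carrier F" for x
    using \<phi>.hom_closed[OF that] by simp
  have \<phi>_add: "\<phi> (x + y) = (\<lambda>v. \<phi> x v + \<phi> y v)" if "x \<in> carrier F" "y \<in> carrier F" for x y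
    using \<phi>.hom_mult[OF that] by (simp add: F_def add_M)
  have \<phi>_0: "\<phi> 0 = (\<lambda>v. 0)"
    using \<phi>.hom_one by (simp add: F_def zero_M)
  have F_diff: "x - y \<in> carrier F" if "x \<in> carrier F" "y \<in> carrier F" for x y
    using that keys_diff[of x y] by (auto simp: F_def)
  have \<phi>_diff: "\<phi> (x - y) = (\<lambda>v. \<phi> x v - \<phi> y v)" if "x \<in> carrier F" "y \<in> carrier F" for x y
    using \<phi>_add[OF F_diff[OF that] that(2)] by (auto simp: fun_eq_iff)
  have F_of: "frag_of (z, s) \<in> carrier F" if "s \<in> carrier ?S" for z s
    using that by (simp add: F_def)
  have \<phi>_rel: "\<phi> x = (\<lambda>v. 0)" if x: "x \<in> tensor_relations ?R ?S ?C" for x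
  proof -
    from x consider
        (1) z z' s where "x = frag_of (z + z', s) - frag_of (z, s) - frag_of (z', s)" "s \<in> carrier ?S"
      | (2) z s s' where "x = frag_of (z, s \<oplus>\<^bsub>?S\<^esub> s') - frag_of (z, s) - frag_of (z, s')"
          "s \<in> carrier ?S" "s' \<in> carrier ?S"
      | (3) z r s where "x = frag_of (z * (\<Sum>g\<in>carrier H. r g), s) - frag_of (z, r \<otimes>\<^bsub>?S\<^esub> s)"
          "r \<in> carrier ?R" "s \<in> carrier ?S"
      unfolding tensor_relations_def C by blast
    then show ?thesis
    proof cases
      case 1
      then show ?thesis
        using F_of by (simp only: \<phi>_diff F_diff \<phi>_of) (simp add: \<Phi>_def fun_scale_def algebra_simps)
    next
      case 2
      then show ?thesis
        using F_of S.a_closed by (simp only: \<phi>_diff F_diff \<phi>_of \<Phi>_add) (simp add: add_M)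
    next
      case 3
      then show ?thesis
        using F_of S.m_closed RS by (simp only: \<phi>_diff F_diff \<phi>_of \<Phi>_mid subset_iff) simp
    qed
  qed
  have \<phi>_N: "\<phi> x = (\<lambda>v. 0)" if "x \<in> N" for x
  proof -
    have "tensor_relations ?R ?S ?C \<subseteq> kernel F (add_monoid M) \<phi>"
      using rel \<phi>_rel by (auto simp: kernel_def zero_M)
    then have "N \<subseteq> kernel F (add_monoid M) \<phi>"
      unfolding N_def by (rule F.generate_subgroup_incl[OF _ \<phi>.subgroup_kernel])
    with that show ?thesis
      by (auto simp: kernel_def zero_M)
  qed

  \<comment> \<open>The decisive bound on the quotient: modulo \<open>N\<close>, a tensor depends
    only on its image under \<open>\<Phi>\<close>. Scalar multiples of single group elements are
    treated directly, and a general \<open>s\<close> by induction on a finite set containing its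
    support.\<close>
  have reduce: "frag_of (z, s) - frag_of (1, \<sigma> (\<Phi> (z, s))) \<in> N" if "s \<in> carrier ?S" for z s
  proof -
    have mono: "frag_of (z, fun_scale c (group_elem g)) -
        frag_of (1, \<sigma> (\<Phi> (z, fun_scale c (group_elem g)))) \<in> N"
      if g: "g \<in> carrier G" for c g
    proof -
      \<comment> \<open>\<open>k\<close> represents the coset of \<open>g\<close>, and
        \<open>l\<close> is the remaining factor in \<open>H\<close>. Moving \<open>l\<close> across
        the tensor sign, where it acts trivially, turns z \<otimes> c g = z \<otimes> (c l) k into
        (z c) \<otimes> k.\<close>
      define k where "k = t (act v0 g)"
      define l where "l = g \<otimes> inv k"
      have k: "k \<in> carrier G" "act v0 k = act v0 g"
        using t[of "act v0 g"] act_in v0 g by (auto simp: k_def)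
      have lk: "l \<otimes> k = g"
        using g k by (simp add: l_def m_assoc)
      have l: "l \<in> carrier H"
        using g k act_inv_eq_iff[of k "act v0 k" v0] v0 act_in
        by (simp add: H l_def) (simp flip: act_comp)
      have oneH: "\<one> \<in> carrier H"
        using v0 act_unit by (simp add: H)
      have sumH: "(\<Sum>x\<in>carrier H. fun_scale d (group_elem h) x) = d" if "h \<in> carrier H" for d h
        using sum_group_elem_mult[OF finH that, of "\<lambda>_. d"] by (simp add: fun_scale_def mult.commute)
      have monoR: "fun_scale d (group_elem h) \<in> carrier ?R" if "h \<in> carrier H" for d h
        using that by (auto simp: fun_scale_def group_elem_def)
      have monok: "group_elem k \<in> carrier ?S"
        by (rule group_elem_in_group_algebra[OF k(1)])
      have mult: "fun_scale d (group_elem h) \<otimes>\<^bsub>?S\<^esub> group_elem k = fun_scale d (group_elem (h \<otimes> k))"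
        if "h \<in> carrier H" for d h
        using mult_fun_scale_group_elem[OF finite_G, of h k d 1] that HG k
        by (auto simp: fun_scale_def)
      have "frag_of (z * c, group_elem k) - frag_of (z, fun_scale c (group_elem g)) \<in> N"
        using N_mid[OF monoR[OF l] monok, of z c] by (simp add: sumH[OF l] mult[OF l] lk)
      \<comment> \<open>The complex factor is moved to the right as a multiple of the identity of
        \<open>H\<close>: the relations of the tensor product mention only elements of the subgroup
        algebra.\<close>
      moreover have "frag_of (z * c, group_elem k) - frag_of (1, fun_scale (z * c) (group_elem k)) \<in> N"
        using N_mid[OF monoR[OF oneH] monok, of 1 "z * c"] k by (simp add: sumH[OF oneH] mult[OF oneH])
      moreover have "\<sigma> (\<Phi> (z, fun_scale c (group_elem g))) = fun_scale (z * c) (group_elem k)"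
      proof
        fix x
        have "\<Phi> (z, fun_scale c (group_elem g)) v = (if act v0 g = v then z * c else 0)" if "v \<in> \<Omega>" for v
          using g finite_G sum_group_elem_mult[OF finite_G g, of "\<lambda>x. if act v0 x = v then c else 0"]
          by (simp add: \<Phi>_apply[OF that] fun_scale_def if_distrib[of "\<lambda>x. _ * x"] mult.commute cong: if_cong)
        then show "\<sigma> (\<Phi> (z, fun_scale c (group_elem g))) x = fun_scale (z * c) (group_elem k) x"
          using k act_in v0 by (auto simp: \<sigma>_def fun_scale_def group_elem_def k_def)
      qed
      ultimately show ?thesis
        using N_trans N_sym by metis
    qed
    have "s \<in> carrier ?S \<Longrightarrow> (\<And>g. g \<notin> A \<Longrightarrow> s g = 0) \<Longrightarrow>
        frag_of (z, s) - frag_of (1, \<sigma> (\<Phi> (z, s))) \<in> N"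
      if "finite A" "A \<subseteq> carrier G" for A s
      using that
    proof (induction A arbitrary: s)
      case empty
      then have "s = (\<lambda>g. 0)" by auto
      moreover have "\<Phi> (z, \<lambda>g. 0) = (\<lambda>v. 0)"
        by (auto simp: \<Phi>_def fun_scale_def smult_M)
      moreover have "\<sigma> (\<lambda>v. 0) = (\<lambda>g. 0)"
        by (auto simp: \<sigma>_def)
      ultimately show ?case
        using N(4)[OF N_zero N_zero] by simp
    next
      case (insert g A)
      define s1 where "s1 = s(g := 0)"
      define s2 where "s2 = fun_scale (s g) (group_elem g)"
      have s: "s = s1 \<oplus>\<^bsub>?S\<^esub> s2"
        by (auto simp: s1_def s2_def fun_scale_def group_elem_def)
      have c1: "s1 \<in> carrier ?S" and c2: "s2 \<in> carrier ?S"
        using insert.prems by (auto simp: s1_def s2_def fun_scale_def group_elem_def)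
      have 1: "frag_of (z, s1) - frag_of (1, \<sigma> (\<Phi> (z, s1))) \<in> N"
        using insert.prems by (intro insert.IH c1) (auto simp: s1_def)
      have 2: "frag_of (z, s2) - frag_of (1, \<sigma> (\<Phi> (z, s2))) \<in> N"
        unfolding s2_def using insert.prems by (intro mono) auto
      have 3: "frag_of (z, s) - frag_of (z, s1) - frag_of (z, s2) \<in> N"
        unfolding s by (rule N_right[OF c1 c2])
      have 4: "frag_of (1, \<sigma> (\<Phi> (z, s))) - frag_of (1, \<sigma> (\<Phi> (z, s1))) - frag_of (1, \<sigma> (\<Phi> (z, s2))) \<in> N"
        using N_right[OF \<sigma>_carrier \<sigma>_carrier, of 1 "\<Phi> (z, s1)" "\<Phi> (z, s2)"]
        by (simp only: s \<Phi>_add[OF c1 c2] add_M \<sigma>_add)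
      show ?case
        using N(4)[OF N(2)[OF N(2)[OF 3 1] 2] 4] by (simp add: algebra_simps)
    qed
    from this[OF finite_G] that show ?thesis by auto
  qed

  \<comment> \<open>Sums of tensors collapse to one tensor as well, because \<open>\<sigma>\<close>
    is additive and additivity in the second factor holds modulo \<open>N\<close>.\<close>
  have reduce_F: "x - frag_of (1, \<sigma> (\<phi> x)) \<in> N" if x: "x \<in> carrier F" for x
  proof -
    have "Poly_Mapping.keys x \<subseteq> UNIV \<times> carrier ?S"
      using x by (simp add: F_def)
    then show ?thesis
    proof (induction x rule: free_Abelian_group_induct[consumes 1, case_names zero diff single])
      case zero
      have "\<sigma> (\<lambda>v. 0) = (\<lambda>g. 0)"
        by (auto simp: \<sigma>_def)
      then show ?case
        using N(3)[OF N_zero] by (simp add: \<phi>_0)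
    next
      case (diff x y)
      then have xF: "x \<in> carrier F" and yF: "y \<in> carrier F"
        by (auto simp: F_def)
      have "\<sigma> (\<phi> x) = \<sigma> (\<phi> (x - y)) \<oplus>\<^bsub>?S\<^esub> \<sigma> (\<phi> y)"
        using xF yF by (auto simp: \<sigma>_def \<phi>_diff)
      then have 3: "frag_of (1, \<sigma> (\<phi> x)) - frag_of (1, \<sigma> (\<phi> (x - y))) - frag_of (1, \<sigma> (\<phi> y)) \<in> N"
        using N_right[OF \<sigma>_carrier \<sigma>_carrier, of 1 "\<phi> (x - y)" "\<phi> y"] by simp
      show ?case
        using N(2)[OF N(4)[OF diff(3,4)] 3] by (simp add: algebra_simps)
    next
      case (single p)
      then show ?case
        using reduce \<phi>_of by (cases p) auto
    qed
  qed

  let ?T = "induced_module H G ?C"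
  have T_carrier: "carrier ?T = (\<lambda>x. N #>\<^bsub>F\<^esub> x) ` carrier F"
    and T_zero: "\<zero>\<^bsub>?T\<^esub> = N"
    and T_add: "\<And>x y. x \<oplus>\<^bsub>?T\<^esub> y = x <#>\<^bsub>F\<^esub> y"
    and T_smult: "\<And>a x. a \<odot>\<^bsub>?T\<^esub> x = N <#>\<^bsub>F\<^esub> (frag_extend (\<lambda>(m, s). frag_of (m, s \<otimes>\<^bsub>?S\<^esub> a)) ` x)"
    by (simp_all add: induced_module_def extend_scalars_def tensor_group_def Let_def C(1)
        carrier_FactGroup del: group_algebra_simps flip: F_def N_def)
  \<comment> \<open>\<open>h\<close> starts from \<open>M\<close>, so \<open>\<phi>\<close> never
    has to be turned into a map on cosets. That \<open>\<phi>\<close> vanishes on \<open>N\<close>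
    gives injectivity of \<open>h\<close>, and \<open>reduce_F\<close> gives surjectivity.\<close>
  define h where "h \<tau> = N #>\<^bsub>F\<^esub> frag_of (1 :: complex, \<sigma> \<tau>)" for \<tau>
  interpret NN: normal N F
    using comm_group.subgroup_imp_normal[OF abelian_free_Abelian_group N_sub[unfolded F_def]]
    by (simp add: F_def)
  show ?thesis
  proof (rule right_module_isomorphicI[where h = h])
    show "right_module ?S M" by (rule right_module)
    show "bij_betw h (carrier M) (carrier ?T)"
    proof (rule bij_betwI')
      fix \<tau> \<tau>' assume \<tau>: "\<tau> \<in> carrier M" "\<tau>' \<in> carrier M"
      show "h \<tau> = h \<tau>' \<longleftrightarrow> \<tau> = \<tau>'"
      proof
        assume "h \<tau> = h \<tau>'"
        then have "\<phi> (frag_of (1, \<sigma> \<tau>) - frag_of (1, \<sigma> \<tau>')) = (\<lambda>v. 0)"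
          by (intro \<phi>_N) (simp add: h_def coset_eq)
        then show "\<tau> = \<tau>'"
          using \<tau> by (simp only: \<phi>_diff F_of \<sigma>_carrier \<phi>_of \<Phi>_\<sigma>) (simp add: fun_eq_iff)
      qed simp
    next
      fix \<tau> assume "\<tau> \<in> carrier M"
      show "h \<tau> \<in> carrier ?T"
        unfolding T_carrier h_def using F_of[OF \<sigma>_carrier] by blast
    next
      fix y assume "y \<in> carrier ?T"
      then obtain x where x: "x \<in> carrier F" "y = N #>\<^bsub>F\<^esub> x"
        by (auto simp: T_carrier)
      then have "y = h (\<phi> x)"
        using reduce_F by (simp add: h_def coset_eq)
      then show "\<exists>\<tau>\<in>carrier M. y = h \<tau>"
        using \<phi>_carrier x by blast
    qed
    show "h \<zero>\<^bsub>M\<^esub> = \<zero>\<^bsub>?T\<^esub>"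
    proof -
      have "\<sigma> \<zero>\<^bsub>M\<^esub> = (\<lambda>g. 0)"
        by (auto simp: \<sigma>_def zero_M)
      moreover have "N #>\<^bsub>F\<^esub> frag_of (1, \<lambda>g. 0) = N #>\<^bsub>F\<^esub> 0"
        using N_zero by (simp add: coset_eq)
      moreover have "N #>\<^bsub>F\<^esub> 0 = N"
        by (auto simp: F_def free_Abelian_group_r_coset)
      ultimately show ?thesis
        by (simp add: h_def T_zero)
    qed
    show "h (\<tau> \<oplus>\<^bsub>M\<^esub> \<tau>') = h \<tau> \<oplus>\<^bsub>?T\<^esub> h \<tau>'" for \<tau> \<tau>'
    proof -
      have "h \<tau> \<oplus>\<^bsub>?T\<^esub> h \<tau>' = N #>\<^bsub>F\<^esub> (frag_of (1, \<sigma> \<tau>) + frag_of (1, \<sigma> \<tau>'))"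
        unfolding T_add h_def using NN.rcos_sum[OF F_of F_of] \<sigma>_carrier by (simp add: F_def)
      also have "\<dots> = h (\<tau> \<oplus>\<^bsub>M\<^esub> \<tau>')"
        unfolding h_def coset_eq
        using N(3)[OF N_right[OF \<sigma>_carrier \<sigma>_carrier, of 1 \<tau> \<tau>']]
        by (simp add: add_M \<sigma>_add algebra_simps)
      finally show ?thesis ..
    qed
    fix a \<tau> assume a: "a \<in> carrier ?S" and \<tau>: "\<tau> \<in> carrier M"
    define \<psi> :: "(complex \<times> ('g \<Rightarrow> complex) \<Rightarrow>\<^sub>0 int) \<Rightarrow> _"
      where "\<psi> = frag_extend (\<lambda>(m, s). frag_of (m, s \<otimes>\<^bsub>?S\<^esub> a))"
    have \<psi>_F: "\<psi> x \<in> carrier F" if "x \<in> carrier F" for x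
    proof -
      have "Poly_Mapping.keys (\<psi> x) \<subseteq>
          (\<Union>p\<in>Poly_Mapping.keys x. Poly_Mapping.keys ((\<lambda>(m, s). frag_of (m, s \<otimes>\<^bsub>?S\<^esub> a)) p))"
        unfolding \<psi>_def by (rule keys_frag_extend)
      also have "\<dots> \<subseteq> UNIV \<times> carrier ?S"
      proof (rule UN_least)
        fix p assume p: "p \<in> Poly_Mapping.keys x"
        obtain m s where p_eq: "p = (m, s)"
          by fastforce
        then have "s \<in> carrier ?S"
          using p that unfolding F_def by (auto simp del: group_algebra_simps)
        then show "Poly_Mapping.keys ((\<lambda>(m, s). frag_of (m, s \<otimes>\<^bsub>?S\<^esub> a)) p) \<subseteq> UNIV \<times> carrier ?S"
          using S.m_closed[OF _ a] by (simp add: p_eq del: group_algebra_simps)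
      qed
      finally show ?thesis
        unfolding F_def by simp
    qed
    have \<psi>_hom: "\<psi> \<in> hom F F"
      by (rule homI) (use \<psi>_F in \<open>simp_all add: F_def \<psi>_def frag_extend_add del: group_algebra_simps\<close>)
    interpret \<psi>: group_hom F F \<psi>
      using \<psi>_hom by unfold_locales
    have "\<psi> ` N \<subseteq> N"
      unfolding N_def \<psi>.generate_img[OF rel, symmetric]
      using frag_extend_tensor_relations[OF S.ring_axioms RS a]
      by (intro F.mono_generate) (auto simp: \<psi>_def)
    then have \<psi>_N: "\<psi> n \<in> N" if "n \<in> N" for n
      using that by blast
    have "N <#>\<^bsub>F\<^esub> (\<psi> ` (N #>\<^bsub>F\<^esub> x)) = N #>\<^bsub>F\<^esub> \<psi> x" for x
    proof (intro equalityI subsetI)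
      fix y assume "y \<in> N <#>\<^bsub>F\<^esub> (\<psi> ` (N #>\<^bsub>F\<^esub> x))"
      then obtain n n' where "n \<in> N" "n' \<in> N" "y = n + \<psi> (n' + x)"
        unfolding F_def free_Abelian_group_r_coset free_Abelian_group_set_mult by blast
      then have "y = (n + \<psi> n') + \<psi> x" "n + \<psi> n' \<in> N"
        using N(2) \<psi>_N by (simp_all add: \<psi>_def frag_extend_add)
      then show "y \<in> N #>\<^bsub>F\<^esub> \<psi> x"
        unfolding F_def free_Abelian_group_r_coset by blast
    next
      fix y assume "y \<in> N #>\<^bsub>F\<^esub> \<psi> x"
      then obtain n where "n \<in> N" "y = n + \<psi> (0 + x)"
        unfolding F_def free_Abelian_group_r_coset by auto
      then show "y \<in> N <#>\<^bsub>F\<^esub> (\<psi> ` (N #>\<^bsub>F\<^esub> x))"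
        using N(1) unfolding F_def free_Abelian_group_r_coset free_Abelian_group_set_mult by blast
    qed
    then have "a \<odot>\<^bsub>?T\<^esub> h \<tau> = N #>\<^bsub>F\<^esub> \<psi> (frag_of (1, \<sigma> \<tau>))"
      by (simp only: T_smult h_def flip: \<psi>_def)
    also have "\<psi> (frag_of (1, \<sigma> \<tau>)) = frag_of (1, \<sigma> \<tau> \<otimes>\<^bsub>?S\<^esub> a)"
      by (simp add: \<psi>_def)
    \<comment> \<open>Right multiplication by \<open>a\<close> may move the support of
      \<open>\<sigma> \<tau>\<close> away from the chosen representatives. \<open>reduce\<close>
      returns to the normal form modulo \<open>N\<close>, and \<open>\<Phi>\<close> identifies which
      normal form it is.\<close>
    also have "N #>\<^bsub>F\<^esub> frag_of (1, \<sigma> \<tau> \<otimes>\<^bsub>?S\<^esub> a) = h (a \<odot>\<^bsub>M\<^esub> \<tau>)"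
    proof -
      have "\<Phi> (1, \<sigma> \<tau> \<otimes>\<^bsub>?S\<^esub> a) = a \<odot>\<^bsub>M\<^esub> \<Phi> (1, \<sigma> \<tau>)"
        unfolding \<Phi>_def prod.case M.act_mult[OF \<sigma>_carrier a elem_v0] by (simp add: fun_scale_def)
      then show ?thesis
        using reduce[OF S.m_closed[OF \<sigma>_carrier a], of 1 \<tau>] \<Phi>_\<sigma>[OF \<tau>] by (simp add: h_def coset_eq)
    qed
    finally show "h (a \<odot>\<^bsub>M\<^esub> \<tau>) = a \<odot>\<^bsub>?T\<^esub> h \<tau>" ..
  qed
qed

end

section \<open>Characters\<close>

interpretation fun_scale: vector_space fun_scale
  by unfold_locales (auto simp: fun_scale_def fun_eq_iff algebra_simps)

lemma fun_scale_mult: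
  "fun_scale c a * b = fun_scale c (a * b)" "a * fun_scale c b = fun_scale c (a * b)"
  by (auto simp: fun_scale_def)

lemma sum_fun_apply: "(\<Sum>i\<in>A. f i) x = (\<Sum>i\<in>A. f i x)"
  for f :: "'i \<Rightarrow> 'a \<Rightarrow> 'b::comm_monoid_add"
  by (induction A rule: infinite_finite_induct) auto

lemma characters_mult:
  "\<psi> \<in> characters G \<Longrightarrow> g \<in> carrier G \<Longrightarrow> h \<in> carrier G \<Longrightarrow> \<psi> (g \<otimes>\<^bsub>G\<^esub> h) = \<psi> g * \<psi> h"
  and characters_nonzero: "\<psi> \<in> characters G \<Longrightarrow> g \<in> carrier G \<Longrightarrow> \<psi> g \<noteq> 0"
  and characters_outside: "\<psi> \<in> characters G \<Longrightarrow> g \<notin> carrier G \<Longrightarrow> \<psi> g = 0"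
  by (auto simp: characters_def hom_def complex_units_def)

lemma charactersI:
  assumes "\<And>g h. g \<in> carrier G \<Longrightarrow> h \<in> carrier G \<Longrightarrow> \<psi> (g \<otimes>\<^bsub>G\<^esub> h) = \<psi> g * \<psi> h"
    and "\<And>g. g \<in> carrier G \<Longrightarrow> \<psi> g \<noteq> 0"
    and "\<And>g. g \<notin> carrier G \<Longrightarrow> \<psi> g = 0"
  shows "\<psi> \<in> characters G"
  using assms by (auto simp: characters_def hom_def complex_units_def)

context group
begin

text \<open>Translation by a point \<open>w\<close> where the characters differ multiplies the sum
  by \<open>\<psi> w / \<psi>' w\<close>, which is not 1. Division replaces the usual complex
  conjugate, so absolute values of characters never enter.\<close>

lemma characters_orthogonal:
  assumes fin: "finite (carrier G)" and \<psi>: "\<psi> \<in> characters G" "\<psi>' \<in> characters G" "\<psi> \<noteq> \<psi>'"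
  shows "(\<Sum>g\<in>carrier G. \<psi> g / \<psi>' g) = 0"
proof -
  obtain w where w: "w \<in> carrier G" "\<psi> w \<noteq> \<psi>' w"
    using \<psi> characters_outside by (metis ext)
  have "bij_betw (\<lambda>g. w \<otimes> g) (carrier G) (carrier G)"
    using w by (simp add: bij_betw_def inj_on_cmult surj_const_mult)
  then have "(\<Sum>g\<in>carrier G. \<psi> g / \<psi>' g) = (\<Sum>g\<in>carrier G. \<psi> (w \<otimes> g) / \<psi>' (w \<otimes> g))"
    by (rule sum.reindex_bij_betw[symmetric])
  also have "\<dots> = (\<psi> w / \<psi>' w) * (\<Sum>g\<in>carrier G. \<psi> g / \<psi>' g)"
    using w \<psi> by (auto simp: characters_mult sum_distrib_left intro!: sum.cong)
  finally show ?thesis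
    using w characters_nonzero[OF \<psi>(2) w(1)] by (auto simp: field_simps)
qed

text \<open>A linear relation is divided by a character \<psi> that occurs in it and then summed
  over the group. Orthogonality leaves only the coefficient of \<psi> times the group order.\<close>

lemma characters_independent:
  assumes fin: "finite (carrier G)"
  shows "\<not> fun_scale.dependent (characters G)"
proof
  assume "fun_scale.dependent (characters G)"
  then obtain T u \<psi> where T: "finite T" "T \<subseteq> characters G" "(\<Sum>\<psi>\<in>T. fun_scale (u \<psi>) \<psi>) = 0"
    and \<psi>: "\<psi> \<in> T" "u \<psi> \<noteq> 0"
    unfolding fun_scale.dependent_explicit by blast
  have "(\<Sum>\<psi>'\<in>T. u \<psi>' * \<psi>' g) = 0" for g
    using T(3) by (simp add: fun_eq_iff sum_fun_apply fun_scale_def)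
  then have "0 = (\<Sum>g\<in>carrier G. (\<Sum>\<psi>'\<in>T. u \<psi>' * \<psi>' g) / \<psi> g)"
    by simp
  also have "\<dots> = (\<Sum>\<psi>'\<in>T. \<Sum>g\<in>carrier G. u \<psi>' * \<psi>' g / \<psi> g)"
    unfolding sum_divide_distrib by (rule sum.swap)
  also have "\<dots> = (\<Sum>\<psi>'\<in>T. u \<psi>' * (\<Sum>g\<in>carrier G. \<psi>' g / \<psi> g))"
    by (simp add: sum_distrib_left)
  also have "\<dots> = (\<Sum>\<psi>'\<in>T. if \<psi>' = \<psi> then u \<psi> * card (carrier G) else 0)"
  proof (rule sum.cong[OF refl])
    fix \<psi>' assume "\<psi>' \<in> T"
    have "(\<Sum>g\<in>carrier G. \<psi> g / \<psi> g) = (\<Sum>g\<in>carrier G. 1)"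
      using characters_nonzero[OF subsetD[OF T(2) \<psi>(1)]] by (intro sum.cong) auto
    then show "u \<psi>' * (\<Sum>g\<in>carrier G. \<psi>' g / \<psi> g) = (if \<psi>' = \<psi> then u \<psi> * card (carrier G) else 0)"
      using characters_orthogonal[OF fin, of \<psi>' \<psi>] T \<psi> \<open>\<psi>' \<in> T\<close> by auto
  qed
  also have "\<dots> = u \<psi> * card (carrier G)"
    using T \<psi> by simp
  finally show False
    using \<psi> fin by auto
qed

text \<open>The span of the characters is an algebra of functions; once it separates points it contains
  the indicator function of every point.\<close>

lemma complex_basis_characters:
  assumes fin: "finite (carrier G)"
    and sep: "\<And>v w. v \<in> carrier G \<Longrightarrow> w \<in> carrier G \<Longrightarrow> v \<noteq> w \<Longrightarrow> \<exists>\<psi>\<in>characters G. \<psi> v \<noteq> \<psi> w"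
  shows "complex_basis (characters G) (carrier (group_algebra G))"
proof -
  let ?W = "fun_scale.span (characters G)"
  have "fun_scale.subspace (carrier (group_algebra G))"
    by (auto simp: fun_scale.subspace_def fun_scale_def)
  then have W_sub: "?W \<subseteq> carrier (group_algebra G)"
    by (rule fun_scale.span_minimal[rotated]) (auto simp: characters_def)
  define e where "e = (\<lambda>g. if g \<in> carrier G then 1 else 0 :: complex)"
  have e: "e \<in> ?W"
    by (rule fun_scale.span_base, rule charactersI) (auto simp: e_def)
  have char_mult: "a * b \<in> ?W" if "a \<in> characters G" "b \<in> ?W" for a b
    using that(2)
  proof (induction b rule: fun_scale.span_induct)
    case base
    show ?case
      unfolding fun_scale.subspace_def
      using fun_scale.span_zero fun_scale.span_add fun_scale.span_scale
      by (auto simp: distrib_left fun_scale_mult)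
  next
    case (step b)
    with that(1) show ?case
      by (intro fun_scale.span_base charactersI) (auto simp: characters_mult characters_nonzero characters_outside)
  qed
  have W_mult: "a * b \<in> ?W" if "a \<in> ?W" "b \<in> ?W" for a b
    using that(1)
  proof (induction a rule: fun_scale.span_induct)
    case base
    show ?case
      unfolding fun_scale.subspace_def
      using fun_scale.span_zero fun_scale.span_add fun_scale.span_scale
      by (auto simp: distrib_right fun_scale_mult)
  qed (use char_mult that in blast)
  have "\<exists>f\<in>?W. f w = 1 \<and> (\<forall>v\<in>A. f v = 0)"
    if w: "w \<in> carrier G" and "finite A" "A \<subseteq> carrier G - {w}" for w A
    using that(2,3)
  proof (induction A)
    case empty
    show ?case
      using e w by (intro bexI[of _ e]) (auto simp: e_def)
  next
    case (insert v A)
    then obtain f where f: "f \<in> ?W" "f w = 1" "\<forall>v\<in>A. f v = 0"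
      by auto
    obtain \<psi> where \<psi>: "\<psi> \<in> characters G" "\<psi> v \<noteq> \<psi> w"
      using sep[of v w] insert w by auto
    \<comment> \<open>A linear factor as in Lagrange interpolation: it vanishes at \<open>v\<close>
      and is 1 at \<open>w\<close>. The constant \<open>\<psi> v\<close> is multiplied by the
      trivial character \<open>e\<close>, since functions in the span vanish outside the
      group.\<close>
    define f' where "f' = fun_scale (1 / (\<psi> w - \<psi> v)) (\<psi> - fun_scale (\<psi> v) e)"
    have "f' \<in> ?W"
      unfolding f'_def using e \<psi>
      by (intro fun_scale.span_scale fun_scale.span_diff) (auto intro: fun_scale.span_base)
    moreover have "f' w = 1" "f' v = 0"
      using \<psi> w insert by (auto simp: f'_def fun_scale_def e_def)
    ultimately show ?case
      using f by (intro bexI[of _ "f * f'"]) (auto intro: W_mult)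
  qed
  then have indicator: "\<exists>f\<in>?W. f w = 1 \<and> (\<forall>v\<in>carrier G - {w}. f v = 0)" if "w \<in> carrier G" for w
    using that fin by simp
  have delta: "group_elem w \<in> ?W" if w: "w \<in> carrier G" for w
  proof -
    obtain f where f: "f \<in> ?W" "f w = 1" "\<forall>v\<in>carrier G - {w}. f v = 0"
      using indicator[OF w] by blast
    have "f = group_elem w"
      using f W_sub w by (force simp: group_elem_def fun_eq_iff)
    with f show ?thesis by simp
  qed
  have "\<tau> \<in> ?W" if \<tau>: "\<tau> \<in> carrier (group_algebra G)" for \<tau>
  proof -
    have "\<tau> = (\<Sum>w\<in>carrier G. fun_scale (\<tau> w) (group_elem w))"
    proof
      fix v
      have "(\<Sum>w\<in>carrier G. fun_scale (\<tau> w) (group_elem w)) v = (\<Sum>w\<in>carrier G. if w = v then \<tau> v else 0)"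
        unfolding sum_fun_apply by (rule sum.cong) (auto simp: fun_scale_def group_elem_def)
      then show "\<tau> v = (\<Sum>w\<in>carrier G. fun_scale (\<tau> w) (group_elem w)) v"
        using \<tau> fin by auto
    qed
    also have "\<dots> \<in> ?W"
      using delta by (intro fun_scale.span_sum fun_scale.span_scale) auto
    finally show ?thesis .
  qed
  then show ?thesis
    unfolding complex_basis_def using W_sub characters_independent[OF fin] by blast
qed

end

text \<open>The character is trivial on an additive subgroup \<open>H\<close> that is maximal among those not containing
  \<open>1\<close>; such an \<open>H\<close> is a complement of the prime field.\<close>

lemma finite_field_additive_character:
  "\<exists>\<psi> :: 'k::{field,finite} \<Rightarrow> complex. (\<forall>x y. \<psi> (x + y) = \<psi> x * \<psi> y) \<and> (\<forall>x. \<psi> x \<noteq> 0) \<and> \<psi> 1 \<noteq> 1"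
proof -
  define p where "p = CHAR('k)"
  have p: "normalization_semidom_class.prime p"
    unfolding p_def using finite_imp_CHAR_pos[where ?'a = 'k] prime_CHAR_semidom[where ?'a = 'k] by simp
  have p0: "of_nat p = (0 :: 'k)"
    unfolding p_def by simp
  have inverse: "\<exists>m'. of_nat m' * of_nat m = (1 :: 'k)" if m: "\<not> p dvd m" for m
  proof -
    have "coprime m p"
      using p m by (metis coprime_commute prime_imp_coprime)
    then obtain m' where "[m * m' = 1] (mod p)"
      using cong_solve_coprime_nat by (metis One_nat_def)
    then have "of_nat (m * m') = (of_nat 1 :: 'k)"
      unfolding p_def by (subst of_nat_eq_iff_cong_CHAR)
    then show ?thesis
      by (intro exI[of _ m']) (simp add: mult.commute)
  qed
  define sub where "sub H \<longleftrightarrow> (0::'k) \<in> H \<and> (\<forall>x\<in>H. \<forall>y\<in>H. x + y \<in> H) \<and> 1 \<notin> H" for H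
  have "sub {0}"
    by (simp add: sub_def)
  then obtain H where H: "sub H" and max: "\<And>H'. sub H' \<Longrightarrow> card H' \<le> card H"
    using ex_has_greatest_nat[of sub "{0}" card "Suc (card (UNIV :: 'k set))"]
    by (auto simp: less_Suc_eq_le card_mono)
  have H0: "0 \<in> H" and Hadd: "\<And>x y. x \<in> H \<Longrightarrow> y \<in> H \<Longrightarrow> x + y \<in> H" and H1: "1 \<notin> H"
    using H by (auto simp: sub_def)
  have Hmult: "of_nat n * x \<in> H" if "x \<in> H" for n x
    using that by (induction n) (auto simp: algebra_simps H0 Hadd)
  \<comment> \<open>In characteristic \<open>p\<close> the element -1 is a multiple of 1 by a
    natural number, so a set closed under addition and containing 0 is closed under negation
    too.\<close>
  have p1: "of_nat (p - 1) = (- 1 :: 'k)"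
    using prime_gt_0_nat[OF p] p0 by (simp add: of_nat_diff)
  have Hneg: "- x \<in> H" if "x \<in> H" for x
    using Hmult[OF that, of "p - 1"] unfolding p1 by simp
  have Hdiff: "x - y \<in> H" if "x \<in> H" "y \<in> H" for x y
    using Hadd[OF that(1) Hneg[OF that(2)]] by simp
  have ex: "\<exists>n. x - of_nat n \<in> H" for x
  proof (cases "x \<in> H")
    case True
    then show ?thesis by (intro exI[of _ 0]) simp
  next
    case False
    \<comment> \<open>Adjoining \<open>x\<close> makes the set strictly larger, so by maximality it
      contains 1. In 1 = h + m x the number \<open>m\<close> is prime to \<open>p\<close>, as
      otherwise 1 would lie in \<open>H\<close>; multiplying by an inverse of \<open>m\<close>
      modulo \<open>p\<close> solves for \<open>x\<close>.\<close>
    define H' where "H' = {h + of_nat m * x | h m. h \<in> H}"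
    have "H \<subseteq> H'"
      unfolding H'_def by (force intro: exI[of _ "0::nat"])
    moreover have "x \<in> H'"
      unfolding H'_def using H0 by (force intro: exI[of _ "1::nat"])
    ultimately have "card H < card H'"
      using False by (intro psubset_card_mono) auto
    then have "\<not> sub H'"
      using max by (meson not_le)
    moreover have "a + b \<in> H'" if "a \<in> H'" "b \<in> H'" for a b
    proof -
      from that obtain h m h' m' where "a = h + of_nat m * x" "b = h' + of_nat m' * x" "h \<in> H" "h' \<in> H"
        unfolding H'_def by blast
      then have "a + b = (h + h') + of_nat (m + m') * x" "h + h' \<in> H"
        by (auto simp: algebra_simps Hadd)
      then show ?thesis
        unfolding H'_def by blast
    qed
    ultimately have "1 \<in> H'"
      using \<open>H \<subseteq> H'\<close> H0 unfolding sub_def by blast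
    then obtain h m where h: "h \<in> H" "1 = h + of_nat m * x"
      unfolding H'_def by blast
    have "\<not> p dvd m"
    proof
      assume "p dvd m"
      then have "of_nat m = (0 :: 'k)"
        by (auto simp: p_def of_nat_eq_0_iff_char_dvd)
      with h H1 show False by simp
    qed
    then obtain m' where m': "of_nat m' * of_nat m = (1 :: 'k)"
      using inverse by blast
    have "of_nat m' = of_nat m' * (h + of_nat m * x)"
      using h by simp
    also have "\<dots> = of_nat m' * h + x"
      using m' by (simp add: distrib_left flip: mult.assoc)
    finally have "x - of_nat m' = - (of_nat m' * h)"
      by (metis add_diff_cancel_right' minus_diff_eq)
    then show ?thesis
      using Hneg[OF Hmult[OF h(1)]] by metis
  qed
  have cong: "[a = b] (mod p)" if "of_nat a - of_nat b \<in> H" for a b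
  proof -
    \<comment> \<open>The difference of \<open>a\<close> and \<open>b\<close> is written with the
      natural number a + (p - 1) b. If it were a unit modulo \<open>p\<close>, a multiple of it in
      \<open>H\<close> would be 1, so \<open>H\<close> meets the prime field only in 0.\<close>
    have d: "of_nat (a + (p - 1) * b) = (of_nat a - of_nat b :: 'k)"
      unfolding of_nat_add of_nat_mult p1 by simp
    have "p dvd a + (p - 1) * b"
    proof (rule ccontr)
      assume "\<not> p dvd a + (p - 1) * b"
      then obtain m' where "of_nat m' * of_nat (a + (p - 1) * b) = (1 :: 'k)"
        using inverse by blast
      then show False
        using Hmult[OF that, of m'] H1 unfolding d by simp
    qed
    then have "of_nat (a + (p - 1) * b) = (0 :: 'k)"
      unfolding p_def of_nat_eq_0_iff_char_dvd .
    with d have "of_nat a = (of_nat b :: 'k)"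
      by simp
    then show ?thesis
      by (simp add: p_def of_nat_eq_iff_cong_CHAR)
  qed
  define \<omega> where "\<omega> = cis (2 * pi / p)"
  have \<omega>: "\<omega> ^ n = cis (2 * pi * n / p)" for n
    unfolding \<omega>_def Complex.DeMoivre by (simp add: mult_ac)
  have "\<omega> ^ p = 1"
    using prime_gt_0_nat[OF p] by (simp add: \<omega>)
  then have \<omega>_cong: "\<omega> ^ a = \<omega> ^ b" if "[a = b] (mod p)" for a b
    using that by (metis (no_types, lifting) cong_def div_mult_mod_eq mult.commute mult_1 power_add power_mult power_one)
  have "\<omega> \<noteq> 1"
  proof
    assume "\<omega> = 1"
    then have "cos (2 * pi / p) = 1"
      by (simp add: \<omega>_def complex_eq_iff)
    \<comment> \<open>Since \<open>p\<close> is at least 2, the angle lies in the interval from 0,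
      excluded, to pi, where the cosine is strictly below 1.\<close>
    moreover have "p \<ge> 2"
      using p by (rule prime_ge_2_nat)
    then have "0 < 2 * pi / p" "2 * pi / p \<le> pi"
      by (auto simp: field_simps)
    ultimately show False
      using cos_monotone_0_pi[of 0 "2 * pi / p"] by simp
  qed
  \<comment> \<open>A natural number congruent to \<open>x\<close> modulo \<open>H\<close>. It is
    determined only modulo \<open>p\<close>, which is all that powers of the \<open>p\<close>-th
    root of unity \<open>\<omega>\<close> depend on.\<close>
  define N where "N x = (SOME n. x - of_nat n \<in> H)" for x
  have N: "x - of_nat (N x) \<in> H" for x
    unfolding N_def using someI_ex[OF ex[of x]] .
  have "\<omega> ^ N (x + y) = \<omega> ^ N x * \<omega> ^ N y" for x y
  proof -
    have "of_nat (N (x + y)) - of_nat (N x + N y) =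
        (x - of_nat (N x)) + (y - of_nat (N y)) - (x + y - of_nat (N (x + y)))"
      by simp
    also have "\<dots> \<in> H"
      by (intro Hdiff Hadd N)
    finally show ?thesis
      using \<omega>_cong[OF cong[of "N (x + y)" "N x + N y"]] by (simp add: power_add)
  qed
  moreover have "\<omega> ^ N 1 = \<omega>"
    using \<omega>_cong[OF cong[of "1" "N 1"]] N[of 1] by simp
  moreover have "\<omega> ^ N x \<noteq> 0" for x
    by (simp add: \<omega>_def)
  ultimately show ?thesis
    using \<open>\<omega> \<noteq> 1\<close> by (intro exI[of _ "\<lambda>x. \<omega> ^ N x"]) auto
qed

section \<open>Pattern groups\<close>

lemma V_set_iff: "A \<in> V_set S \<longleftrightarrow> (\<forall>i j. A $ i $ j \<noteq> 0 \<longrightarrow> (i, j) \<in> S)"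
  by (auto simp: V_set_def supp_def)

lemma V_set_zero: "0 \<in> V_set S"
  and V_set_add: "A \<in> V_set S \<Longrightarrow> B \<in> V_set S \<Longrightarrow> A + B \<in> V_set S"
  and V_set_diff: "A \<in> V_set S \<Longrightarrow> B \<in> V_set S \<Longrightarrow> A - B \<in> V_set S"
  and V_set_uminus: "A \<in> V_set S \<Longrightarrow> - A \<in> V_set S"
  and V_set_mono: "S \<subseteq> T \<Longrightarrow> A \<in> V_set S \<Longrightarrow> A \<in> V_set T"
  unfolding V_set_iff by (auto, force+)

lemma V_set_mult:
  assumes "A \<in> V_set S" "B \<in> V_set T"
    and "\<And>i j k. (i, j) \<in> S \<Longrightarrow> (j, k) \<in> T \<Longrightarrow> (i, k) \<in> R"
  shows "A ** B \<in> V_set R"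
  unfolding V_set_iff
proof (intro allI impI)
  fix i k assume "(A ** B) $ i $ k \<noteq> 0"
  then have "(\<Sum>j\<in>UNIV. A $ i $ j * B $ j $ k) \<noteq> 0"
    by (simp only: matrix_matrix_mult_def vec_lambda_beta not_False_eq_True)
  then obtain j where "A $ i $ j * B $ j $ k \<noteq> 0"
    by (rule sum.not_neutral_contains_not_neutral)
  then have "(i, j) \<in> S" "(j, k) \<in> T"
    using assms(1,2) unfolding V_set_iff by auto
  then show "(i, k) \<in> R"
    by (rule assms(3))
qed

lemma U_group_simps [simp]:
  "\<one>\<^bsub>U_group S\<^esub> = mat 1" "u \<otimes>\<^bsub>U_group S\<^esub> v = u ** v"
  "monoid.mult (U_group S) = (**)"
  by (simp_all add: U_group_def)

lemma U_group_iff: "u \<in> carrier (U_group S) \<longleftrightarrow> u - mat 1 \<in> V_set S"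
proof
  have "mat 1 + A \<in> carrier (U_group S)" if "A \<in> V_set S" for A
    using that by (auto simp: U_group_def)
  from this[of "u - mat 1"] show "u \<in> carrier (U_group S)" if "u - mat 1 \<in> V_set S"
    using that by simp
qed (auto simp: U_group_def)

lemma U_group_mono: "S \<subseteq> T \<Longrightarrow> u \<in> carrier (U_group S) \<Longrightarrow> u \<in> carrier (U_group T)"
  using V_set_mono by (auto simp: U_group_iff)

lemma matrix_add_rdistrib: "(B + C) ** A = B ** A + C ** A"
  for A :: "'a::semiring_1^'n^'m" and B C :: "'a^'m^'l"
  by (simp add: matrix_matrix_mult_def vec_eq_iff sum.distrib distrib_right)

lemma matrix_sub_ldistrib: "A ** (B - C) = A ** B - A ** C"
  for A :: "'a::ring_1^'m^'l" and B C :: "'a^'n^'m"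
  by (simp add: matrix_matrix_mult_def vec_eq_iff sum_subtractf right_diff_distrib)

lemma matrix_sub_rdistrib: "(B - C) ** A = B ** A - C ** A"
  for A :: "'a::ring_1^'n^'m" and B C :: "'a^'m^'l"
  by (simp add: matrix_matrix_mult_def vec_eq_iff sum_subtractf left_diff_distrib)

text \<open>For u = E + A and v = E + B this is (E + A)(E + B) - E = AB + A + B, which reduces
  statements about the group to statements about sums and products of its nilpotent parts.\<close>

lemma mult_minus_one_eq:
  "u ** v - mat 1 = (u - mat 1) ** (v - mat 1) + (u - mat 1) + (v - mat 1)"
  for u v :: "'a::ring_1^'n^'n"
  by (simp add: matrix_sub_ldistrib matrix_sub_rdistrib algebra_simps)

lemma add_one_mult: "(A + mat 1) ** (B + mat 1) = A ** B + A + B + mat 1"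
  for A B :: "'a::semiring_1^'n^'n"
  by (simp add: matrix_add_ldistrib matrix_add_rdistrib ac_simps)

lemma U_group_mult_closed:
  assumes "trans S" "u \<in> carrier (U_group S)" "v \<in> carrier (U_group S)"
  shows "u ** v \<in> carrier (U_group S)"
proof -
  have "(u - mat 1) ** (v - mat 1) \<in> V_set S"
    using assms unfolding U_group_iff by (intro V_set_mult) (auto dest: transD)
  then show ?thesis
    using assms unfolding U_group_iff mult_minus_one_eq by (intro V_set_add)
qed

text \<open>Forward substitution: row \<open>i\<close> of \<open>D\<close> is a combination of the
  rows of smaller index, which vanish by induction. The number of indices below \<open>i\<close>
  serves as the measure.\<close>

lemma unitriangular_mult_eq_0:
  fixes A D :: "('k::{field,finite}, 'n::{finite,linorder}) sq_matrix"
  assumes A: "A \<in> V_set S" "S \<subseteq> Phi_minus" and D: "(mat 1 + A) ** D = 0"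
  shows "D = 0"
proof -
  have D_eq: "D + A ** D = 0"
    using D by (simp add: matrix_add_rdistrib)
  have "D $ i = 0" for i
  proof (induction "card {..<i}" arbitrary: i rule: less_induct)
    case less
    have "A $ i $ j * D $ j $ k = 0" for j k
    proof (cases "j < i")
      case True
      then have "card {..<j} < card {..<i}"
        by (intro psubset_card_mono) auto
      then show ?thesis using less by simp
    next
      case False
      then have "A $ i $ j = 0"
        using A by (auto simp: V_set_iff Phi_minus_def)
      then show ?thesis by simp
    qed
    then have "(A ** D) $ i $ k = 0" for k
      by (simp add: matrix_matrix_mult_def sum.neutral)
    then have "D $ i $ k = 0" for k
      using arg_cong[OF D_eq, of "\<lambda>M. M $ i $ k"] by simp
    then show ?case
      by (simp add: vec_eq_iff)
  qed
  then show ?thesis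
    by (simp add: vec_eq_iff)
qed

text \<open>Inverses come from finiteness: left multiplication by \<open>u\<close> is injective,
  hence surjective on the finite carrier and reaches the identity matrix. A one-sided inverse of a
  square matrix is two-sided, which gives the left inverse required.\<close>

lemma U_group_group:
  fixes S :: "('n::{finite,linorder} \<times> 'n) set"
  assumes S: "S \<subseteq> Phi_minus" "trans S"
  shows "group (U_group S :: ('k::{field,finite}, 'n) sq_matrix monoid)"
proof (rule groupI)
  let ?U = "U_group S :: ('k, 'n) sq_matrix monoid"
  fix u assume u: "u \<in> carrier ?U"
  have "inj_on (\<lambda>x. u ** x) (carrier ?U)"
  proof (rule inj_onI)
    fix x y :: "('k, 'n) sq_matrix"
    assume "u ** x = u ** y"
    then have "(mat 1 + (u - mat 1)) ** (x - y) = 0"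
      by (simp add: matrix_sub_ldistrib)
    then show "x = y"
      using unitriangular_mult_eq_0[of "u - mat 1" S "x - y"] u S by (simp add: U_group_iff)
  qed
  moreover have "(\<lambda>x. u ** x) ` carrier ?U \<subseteq> carrier ?U"
    using U_group_mult_closed[OF S(2) u] by auto
  ultimately have "(\<lambda>x. u ** x) ` carrier ?U = carrier ?U"
    by (intro endo_inj_surj) auto
  moreover have "mat 1 \<in> carrier ?U"
    by (simp add: U_group_iff V_set_zero)
  ultimately obtain x where "x \<in> carrier ?U" "u ** x = mat 1"
    by (metis imageE)
  then show "\<exists>x\<in>carrier ?U. x \<otimes>\<^bsub>?U\<^esub> u = \<one>\<^bsub>?U\<^esub>"
    using matrix_left_right_inverse[of u x] by auto
qed (use S in \<open>auto simp: U_group_mult_closed matrix_mul_assoc\<close>, simp add: U_group_iff V_set_zero)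

lemma V_group_group: "group (V_group S)"
  by (rule groupI)
    (auto simp: V_group_def V_set_zero V_set_add add.assoc intro!: bexI[of _ "- x" for x] V_set_uminus)

text \<open>The field character is known to be nontrivial only at 1. Hence an entry where the
  matrices differ is scaled by \<open>c\<close> so that it takes the value 1 on
  \<open>A - B\<close>.\<close>

lemma V_group_characters_separate:
  fixes A B :: "('k::{field,finite}, 'n::{finite,linorder}) sq_matrix"
  assumes "A \<in> V_set S" "B \<in> V_set S" "A \<noteq> B"
  shows "\<exists>\<psi>\<in>characters (V_group S). \<psi> A \<noteq> \<psi> B"
proof -
  obtain \<theta> :: "'k \<Rightarrow> complex" where \<theta>: "\<And>x y. \<theta> (x + y) = \<theta> x * \<theta> y" "\<And>x. \<theta> x \<noteq> 0" "\<theta> 1 \<noteq> 1"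
    using finite_field_additive_character by blast
  obtain i j where ij: "A $ i $ j \<noteq> B $ i $ j"
    using assms by (auto simp: vec_eq_iff)
  define c where "c = 1 / (A $ i $ j - B $ i $ j)"
  define \<psi> where "\<psi> C = (if C \<in> V_set S then \<theta> (c * C $ i $ j) else 0)" for C
  have "\<psi> \<in> characters (V_group S)"
    by (rule charactersI) (auto simp: V_group_def \<psi>_def V_set_add distrib_left \<theta>)
  moreover have "c * A $ i $ j = 1 + c * B $ i $ j"
    using ij by (simp add: c_def field_simps)
  then have "\<psi> A \<noteq> \<psi> B"
    using \<theta> assms by (simp add: \<psi>_def)
  ultimately show ?thesis by blast
qed

text \<open>Normality of the pattern subgroup appears here as a condition on positions, the two
  ideal properties, which say that V_J is a two-sided ideal of V_K. The locale is thereby free of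
  the field type.\<close>

locale pattern_pair =
  fixes J L :: "('n::{finite,linorder} \<times> 'n) set"
  assumes J_sub: "J \<subseteq> Phi_minus" and L_sub: "L \<subseteq> Phi_minus"
    and J_trans: "trans J" and L_trans: "trans L" and K_trans: "trans (J \<union> L)"
    and disjoint: "J \<inter> L = {}"
    and ideal_right: "(i, j) \<in> J \<Longrightarrow> (j, k) \<in> J \<union> L \<Longrightarrow> (i, k) \<in> J"
    and ideal_left: "(i, j) \<in> J \<union> L \<Longrightarrow> (j, k) \<in> J \<Longrightarrow> (i, k) \<in> J"
begin

abbreviation U :: "('k::{field,finite}, 'n) sq_matrix monoid" where
  "U \<equiv> U_group (J \<union> L)"

lemma U_group_J: "group (U_group J :: ('k::{field,finite}, 'n) sq_matrix monoid)"
  and U_group_K: "group (U :: ('k::{field,finite}, 'n) sq_matrix monoid)"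
  using J_sub L_sub J_trans K_trans by (simp_all add: U_group_group)

lemma U_inv_mult:
  assumes "g \<in> carrier U"
  shows "inv\<^bsub>U\<^esub> g \<in> carrier U" "inv\<^bsub>U\<^esub> g ** g = mat 1" "g ** inv\<^bsub>U\<^esub> g = mat 1"
    "inv\<^bsub>U\<^esub> (inv\<^bsub>U\<^esub> g) = g"
  using assms group.inv_closed[OF U_group_K] group.l_inv[OF U_group_K]
    group.r_inv[OF U_group_K] group.inv_inv[OF U_group_K] by auto

text \<open>The identity holds for each product of two entries separately. If one position lies in
  \<open>J\<close>, so does the composed one by the ideal properties; if both lie in
  \<open>L\<close>, the composed one lies in \<open>L\<close> and hence outside
  \<open>J\<close>.\<close>

lemma rho_lin_mult:
  assumes A: "A \<in> V_set (J \<union> L)" and B: "B \<in> V_set (J \<union> L)"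
  shows "rho_lin J (A ** B) = rho_lin J A ** rho_lin J B"
proof -
  have "(if (i, k) \<in> J then 0 else A $ i $ j * B $ j $ k) =
      (if (i, j) \<in> J then 0 else A $ i $ j) * (if (j, k) \<in> J then 0 else B $ j $ k)" for i j k
  proof (cases "A $ i $ j = 0 \<or> B $ j $ k = 0")
    case False
    then have "(i, j) \<in> J \<union> L" "(j, k) \<in> J \<union> L"
      using A B by (auto simp: V_set_iff)
    then show ?thesis
      using ideal_left[of i j k] ideal_right[of i j k] transD[OF L_trans, of i j k] disjoint by auto
  qed auto
  note entries = this
  have "(if (i, k) \<in> J then 0 else \<Sum>j\<in>UNIV. A $ i $ j * B $ j $ k) =
      (\<Sum>j\<in>UNIV. (if (i, j) \<in> J then 0 else A $ i $ j) * (if (j, k) \<in> J then 0 else B $ j $ k))" for i k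
    unfolding entries[symmetric] by simp
  then show ?thesis
    by (simp only: rho_lin_def matrix_matrix_mult_def vec_eq_iff vec_lambda_beta) simp
qed

lemma rho_lin_add: "rho_lin J (A + B) = rho_lin J A + rho_lin J B"
  by (simp add: rho_lin_def vec_eq_iff)

lemma rho_mult:
  assumes u: "u \<in> carrier U" and v: "v \<in> carrier U"
  shows "rho J (u ** v) = rho J u ** rho J v"
  using u v unfolding U_group_iff
  by (simp only: rho_def mult_minus_one_eq rho_lin_add rho_lin_mult add_one_mult)

lemma rho_in_L:
  assumes "u \<in> carrier U"
  shows "rho J u \<in> carrier (U_group L)"
  using assms by (auto simp: U_group_iff rho_def rho_lin_def V_set_iff)

lemma rho_in_U: "u \<in> carrier U \<Longrightarrow> rho J u \<in> carrier U"
  by (rule U_group_mono[OF _ rho_in_L]) auto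

lemma rho_L:
  assumes "u \<in> carrier (U_group L)"
  shows "rho J u = u"
proof -
  have "rho_lin J (u - mat 1) = u - mat 1"
    unfolding rho_lin_def vec_eq_iff
    using assms disjoint unfolding U_group_iff V_set_iff by (simp only: vec_lambda_beta) auto
  then show ?thesis
    by (simp add: rho_def)
qed

lemma rho_one: "rho J (mat 1) = mat 1"
  by (rule rho_L) (simp add: U_group_iff V_set_zero)

lemma rho_eq_1_iff:
  assumes "u \<in> carrier U"
  shows "rho J u = mat 1 \<longleftrightarrow> u \<in> carrier (U_group J)"
proof -
  have "rho J u = mat 1 \<longleftrightarrow> rho_lin J (u - mat 1) = 0"
    by (simp add: rho_def)
  also have "\<dots> \<longleftrightarrow> (\<forall>i j. (i, j) \<in> J \<or> (u - mat 1) $ i $ j = 0)"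
    unfolding rho_lin_def vec_eq_iff by (simp only: vec_lambda_beta zero_index) auto
  also have "\<dots> \<longleftrightarrow> u \<in> carrier (U_group J)"
    unfolding U_group_iff V_set_iff by blast
  finally show ?thesis .
qed

lemma rho_inv_mult:
  assumes "g \<in> carrier U"
  shows "rho J (inv\<^bsub>U\<^esub> g) ** rho J g = mat 1" "rho J g ** rho J (inv\<^bsub>U\<^esub> g) = mat 1"
  using assms by (simp_all add: U_inv_mult rho_one flip: rho_mult)

section \<open>The affine action of U_K on V and its cocycle\<close>

definition affine_act where
  "affine_act A g = circ_act J L A g + cocycle J L g"

lemma affine_act_eq: "mat 1 + affine_act A g = rho J (inv\<^bsub>U\<^esub> g) ** (mat 1 + A) ** g"
  by (simp add: affine_act_def circ_act_def cocycle_def matrix_add_ldistrib matrix_add_rdistrib)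

text \<open>\<rho> fixes its own values and sends E + A to E, so it maps the product
  \<rho>(\<open>inv g\<close>) (E + A) g to \<rho>(\<open>inv g\<close>) \<rho>(g) = E. The product
  thus lies in the kernel U_J.\<close>

lemma affine_act_in:
  assumes A: "A \<in> V_set J" and g: "g \<in> carrier U"
  shows "affine_act A g \<in> V_set J"
proof -
  have A': "mat 1 + A \<in> carrier (U_group J)" "mat 1 + A \<in> carrier U"
    using A V_set_mono[of J "J \<union> L" A] by (auto simp: U_group_iff)
  let ?r = "rho J (inv\<^bsub>U\<^esub> g)"
  have r: "?r \<in> carrier U"
    using g by (simp add: rho_in_U U_inv_mult)
  have rA: "?r ** (mat 1 + A) \<in> carrier U"
    using U_group_mult_closed[OF K_trans r A'(2)] .
  have rAg: "?r ** (mat 1 + A) ** g \<in> carrier U"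
    using U_group_mult_closed[OF K_trans rA g] .
  have "rho J (?r ** (mat 1 + A) ** g) = rho J ?r ** rho J (mat 1 + A) ** rho J g"
    by (simp add: rho_mult[OF rA g] rho_mult[OF r A'(2)])
  also have "\<dots> = mat 1"
    using rho_eq_1_iff[OF A'(2)] A' rho_L[OF rho_in_L[OF U_inv_mult(1)[OF g]]] rho_inv_mult[OF g] by simp
  finally have "mat 1 + affine_act A g \<in> carrier (U_group J)"
    using rho_eq_1_iff[OF rAg] by (simp add: affine_act_eq)
  then show ?thesis
    by (simp add: U_group_iff)
qed

lemma affine_act_mult:
  assumes "g \<in> carrier U" "h \<in> carrier U"
  shows "affine_act (affine_act A g) h = affine_act A (g ** h)"
proof -
  have "inv\<^bsub>U\<^esub> (g ** h) = inv\<^bsub>U\<^esub> h ** inv\<^bsub>U\<^esub> g"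
    using group.inv_mult_group[OF U_group_K assms] by simp
  then have "rho J (inv\<^bsub>U\<^esub> (g ** h)) = rho J (inv\<^bsub>U\<^esub> h) ** rho J (inv\<^bsub>U\<^esub> g)"
    using assms by (simp add: rho_mult U_inv_mult)
  then have "mat 1 + affine_act (affine_act A g) h = mat 1 + affine_act A (g ** h)"
    by (simp add: affine_act_eq matrix_mul_assoc)
  then show ?thesis by simp
qed

lemma affine_act_zero: "affine_act 0 g = cocycle J L g"
  by (simp add: affine_act_def circ_act_def)

lemma cocycle_in: "g \<in> carrier U \<Longrightarrow> cocycle J L g \<in> V_set J"
  using affine_act_in[OF V_set_zero] by (simp add: affine_act_zero)

text \<open>Multiplying \<rho>(\<open>inv g\<close>) g = E by \<rho>(g) shows that the zeros of the
  cocycle are the fixed points of \<rho>, and a projection onto U_L fixes exactly U_L.\<close>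

lemma cocycle_eq_0_iff:
  assumes "g \<in> carrier U"
  shows "cocycle J L g = 0 \<longleftrightarrow> g \<in> carrier (U_group L)"
proof -
  have "cocycle J L g = 0 \<longleftrightarrow> rho J (inv\<^bsub>U\<^esub> g) ** g = mat 1"
    by (simp add: cocycle_def)
  also have "\<dots> \<longleftrightarrow> g = rho J g"
  proof
    assume "rho J (inv\<^bsub>U\<^esub> g) ** g = mat 1"
    then have "rho J g ** rho J (inv\<^bsub>U\<^esub> g) ** g = rho J g"
      by (metis matrix_mul_assoc matrix_mul_rid)
    then show "g = rho J g"
      using rho_inv_mult[OF assms] by simp
  next
    assume "g = rho J g"
    then show "rho J (inv\<^bsub>U\<^esub> g) ** g = mat 1"
      using rho_inv_mult(1)[OF assms] by simp
  qed
  also have "\<dots> \<longleftrightarrow> g \<in> carrier (U_group L)"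
    using rho_L rho_in_L[OF assms] by metis
  finally show ?thesis .
qed

lemma cocycle_J:
  assumes "g \<in> carrier (U_group J)"
  shows "cocycle J L g = g - mat 1"
proof -
  have g: "g \<in> carrier U"
    using U_group_mono[OF _ assms] by auto
  have "rho J (inv\<^bsub>U\<^esub> g) = mat 1"
    using rho_inv_mult[OF g] rho_eq_1_iff[OF g] assms by simp
  then show ?thesis
    by (simp add: cocycle_def)
qed

text \<open>The linear part of the affine action is the difference of its values at \<open>A\<close>
  and at 0, both of which are already known to lie in V_J.\<close>

lemma circ_act_in:
  assumes "A \<in> V_set J" "g \<in> carrier U"
  shows "circ_act J L A g \<in> V_set J"
  using V_set_diff[OF affine_act_in[OF assms] cocycle_in[OF assms(2)]] by (simp add: affine_act_def)

lemma circ_act_add: "circ_act J L (A + B) g = circ_act J L A g + circ_act J L B g"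
  by (simp add: circ_act_def matrix_add_ldistrib matrix_add_rdistrib)

lemma circ_act_inv:
  assumes "g \<in> carrier U"
  shows "circ_act J L (circ_act J L A g) (inv\<^bsub>U\<^esub> g) = A"
proof -
  have "circ_act J L (circ_act J L A g) (inv\<^bsub>U\<^esub> g) =
      (rho J g ** rho J (inv\<^bsub>U\<^esub> g)) ** A ** (g ** inv\<^bsub>U\<^esub> g)"
    using assms by (simp add: circ_act_def U_inv_mult flip: matrix_mul_assoc)
  then show ?thesis
    using assms by (simp add: rho_inv_mult U_inv_mult)
qed

lemma permutation_module_CV:
  "permutation_module (U :: ('k::{field,finite}, 'n) sq_matrix monoid) (V_set J) affine_act (CV_module J L)"
proof -
  interpret U: group "U :: ('k, 'n) sq_matrix monoid"
    by (rule U_group_K)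
  show ?thesis
  proof (unfold_locales, goal_cases)
    case (3 A)
    have "mat 1 + affine_act A (mat 1) = mat 1 + A"
      using U.inv_one by (simp add: affine_act_eq rho_one)
    then show ?case by simp
  qed (simp_all add: affine_act_in affine_act_mult,
      simp_all add: affine_act_def CV_module_def Let_def V_group_def group_algebra_def fun_eq_iff)
qed

section \<open>The linear action on characters\<close>

lemma dot_char_in:
  assumes "\<psi> \<in> characters (V_group J)" "g \<in> carrier U"
  shows "dot_char J L \<psi> g \<in> characters (V_group J)"
  using assms characters_mult[OF assms(1)] characters_nonzero[OF assms(1)]
  by (intro charactersI) (auto simp: dot_char_def V_group_def circ_act_add circ_act_in V_set_add U_inv_mult)

lemma bij_betw_dot_char:
  assumes g: "g \<in> carrier U"
  shows "bij_betw (\<lambda>\<psi>. dot_char J L \<psi> g) (characters (V_group J)) (characters (V_group J))"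
proof (rule bij_betw_byWitness[where f' = "\<lambda>\<psi>. dot_char J L \<psi> (inv\<^bsub>U\<^esub> g)"])
  have "dot_char J L (dot_char J L \<psi> h) (inv\<^bsub>U\<^esub> h) = \<psi>"
    if "\<psi> \<in> characters (V_group J)" "h \<in> carrier U" for \<psi> h
    using that characters_outside[OF that(1)]
    by (auto simp: dot_char_def fun_eq_iff U_inv_mult circ_act_in circ_act_inv V_group_def)
  from this[OF _ g] this[OF _ U_inv_mult(1)[OF g]] g
  show "\<forall>\<psi>\<in>characters (V_group J). dot_char J L (dot_char J L \<psi> g) (inv\<^bsub>U\<^esub> g) = \<psi>"
    and "\<forall>\<psi>\<in>characters (V_group J). dot_char J L (dot_char J L \<psi> (inv\<^bsub>U\<^esub> g)) g = \<psi>"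
    by (simp_all add: U_inv_mult)
qed (use g in \<open>auto simp: dot_char_in U_inv_mult\<close>)

end

text \<open>The product (E + e_ij)(E + e_jk) has entry 1 at position (i, k). Equality of left and
  right cosets moves the factor from U_J to the other side, where it becomes some \<open>u\<close>
  in U_J. The factor from U_K does not affect that entry, so \<open>u\<close> has entry 1 there and
  (i, k) belongs to \<open>J\<close>.\<close>

lemma normal_pattern_ideal:
  fixes J K :: "('n::{finite,linorder} \<times> 'n) set"
  assumes K: "K \<subseteq> Phi_minus" "J \<subseteq> K"
    and normal: "carrier (U_group J :: ('k::{field,finite}, 'n) sq_matrix monoid) \<lhd> U_group K"
  shows "(i, j) \<in> J \<Longrightarrow> (j, k) \<in> K \<Longrightarrow> (i, k) \<in> J"
    and "(i, j) \<in> K \<Longrightarrow> (j, k) \<in> J \<Longrightarrow> (i, k) \<in> J"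
proof -
  interpret normal "carrier (U_group J :: ('k, 'n) sq_matrix monoid)" "U_group K"
    by (rule normal)
  define e :: "'n \<Rightarrow> 'n \<Rightarrow> ('k, 'n) sq_matrix" where "e a b = (\<chi> x y. if x = a \<and> y = b then 1 else 0)" for a b
  have e_mult: "e a b ** M = (\<chi> x y. if x = a then M $ b $ y else 0)" for a b M
    by (auto simp: e_def matrix_matrix_mult_def vec_eq_iff if_distrib[of "\<lambda>x. x * _"] cong: if_cong)
  have mult_e: "M ** e a b = (\<chi> x y. if y = b then M $ x $ a else 0)" for a b M
    by (auto simp: e_def matrix_matrix_mult_def vec_eq_iff if_distrib[of "\<lambda>x. _ * x"] cong: if_cong)
  have e_in: "mat 1 + e a b \<in> carrier (U_group S)" if "(a, b) \<in> S" for a b S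
    using that by (auto simp: U_group_iff e_def V_set_iff)
  have lt: "b < a" if "(a, b) \<in> K" for a b
    using that K by (auto simp: Phi_minus_def)
  show "(i, k) \<in> J" if "(i, j) \<in> J" "(j, k) \<in> K"
  proof -
    \<comment> \<open>All positions lie strictly below the diagonal, so k < j < i. In particular (i,
      k) is off the diagonal, where a nonzero entry of \<open>u\<close> can come only from its part
      in V_J.\<close>
    have ne: "i \<noteq> j" "j \<noteq> k" "i \<noteq> k"
      using that lt[of i j] lt[of j k] K by auto
    have "(mat 1 + e i j) ** (mat 1 + e j k) \<in> carrier (U_group J) #>\<^bsub>U_group K\<^esub> (mat 1 + e j k)"
      using e_in[OF that(1)] by (auto simp: r_coset_def)
    also have "\<dots> = (mat 1 + e j k) <#\<^bsub>U_group K\<^esub> carrier (U_group J)"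
      using coset_eq e_in[OF that(2)] by blast
    finally obtain u where u: "u \<in> carrier (U_group J)"
      "(mat 1 + e i j) ** (mat 1 + e j k) = (mat 1 + e j k) ** u"
      by (auto simp: l_coset_def)
    have "((mat 1 + e i j) ** (mat 1 + e j k)) $ i $ k = ((mat 1 + e j k) ** u) $ i $ k"
      by (simp add: u)
    then have "u $ i $ k = 1"
      using ne ne[symmetric]
      by (simp add: matrix_add_ldistrib matrix_add_rdistrib e_mult) (simp add: e_def mat_def)
    then show ?thesis
      using u(1) ne by (auto simp: U_group_iff V_set_iff mat_def)
  qed
  show "(i, k) \<in> J" if "(i, j) \<in> K" "(j, k) \<in> J"
  proof -
    have ne: "i \<noteq> j" "j \<noteq> k" "i \<noteq> k"
      using that lt[of i j] lt[of j k] K by auto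
    have "(mat 1 + e i j) ** (mat 1 + e j k) \<in> (mat 1 + e i j) <#\<^bsub>U_group K\<^esub> carrier (U_group J)"
      using e_in[OF that(2)] by (auto simp: l_coset_def)
    also have "\<dots> = carrier (U_group J) #>\<^bsub>U_group K\<^esub> (mat 1 + e i j)"
      using coset_eq e_in[OF that(1)] by blast
    finally obtain u where u: "u \<in> carrier (U_group J)"
      "(mat 1 + e i j) ** (mat 1 + e j k) = u ** (mat 1 + e i j)"
      by (auto simp: r_coset_def)
    have "((mat 1 + e i j) ** (mat 1 + e j k)) $ i $ k = (u ** (mat 1 + e i j)) $ i $ k"
      by (simp add: u)
    then have "u $ i $ k = 1"
      using ne ne[symmetric]
      by (simp add: matrix_add_ldistrib matrix_add_rdistrib e_mult mult_e) (simp add: e_def mat_def)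
    then show ?thesis
      using u(1) ne by (auto simp: U_group_iff V_set_iff mat_def)
  qed
qed

theorem theorem3p9:
  fixes J L K :: "('n::{finite,linorder} \<times> 'n) set"
    and U_J U_L U_K V :: "('k::{field,finite}, 'n) sq_matrix monoid"
    and f :: "('k, 'n) sq_matrix \<Rightarrow> ('k, 'n) sq_matrix"
    and CV :: "(('k, 'n) sq_matrix \<Rightarrow> complex, ('k, 'n) sq_matrix \<Rightarrow> complex) module"
    and Vhat :: "(('k, 'n) sq_matrix \<Rightarrow> complex) set"
  assumes J: "J \<subseteq> Phi_minus" "trans J"
    and L: "L \<subseteq> Phi_minus" "trans L"
    and disjoint: "J \<inter> L = {}"
    and K: "K = J \<union> L" "trans K"
    and U_defs: "U_J = U_group J" "U_L = U_group L" "U_K = U_group K"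
    and normal: "carrier U_J \<lhd> U_K"
    and V_def: "V = V_group J"
    and f_def: "f = cocycle J L"
    and CV_def: "CV = CV_module J L"
    and Vhat_def: "Vhat = characters V"
  shows
    "right_module (group_algebra U_K) CV \<and>
     \<comment> \<open>1)\<close>
     complex_basis Vhat (carrier CV) \<and>
     (\<forall>g\<in>carrier U_K.
        bij_betw (\<lambda>\<psi>. dot_char J L \<psi> g) Vhat Vhat \<and>
        (\<forall>\<psi>\<in>Vhat. \<psi> (f (inv\<^bsub>U_K\<^esub> g)) \<noteq> 0 \<and>
           group_elem g \<odot>\<^bsub>CV\<^esub> \<psi> = fun_scale (\<psi> (f (inv\<^bsub>U_K\<^esub> g))) (dot_char J L \<psi> g))) \<and>
     \<comment> \<open>2)\<close>
     right_module_isomorphic (group_algebra U_K) CV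
       (induced_module U_L U_K (trivial_module U_L)) \<and>
     \<comment> \<open>3)\<close>
     right_module_isomorphic (group_algebra U_J) CV
       (regular_right_module (group_algebra U_J)) \<and>
     \<comment> \<open>4)\<close>
     (\<forall>g\<in>carrier U_L. f (inv\<^bsub>U_K\<^esub> g) = 0 \<and>
        (\<forall>\<psi>\<in>Vhat. \<psi> (f (inv\<^bsub>U_K\<^esub> g)) = 1) \<and>
        bij_betw (\<lambda>\<psi>. group_elem g \<odot>\<^bsub>CV\<^esub> \<psi>) Vhat Vhat)"
proof -
  have "pattern_pair J L"
  proof
    have KP: "K \<subseteq> Phi_minus" "J \<subseteq> K"
      using J L K by auto
    show "(i, k) \<in> J" if "(i, j) \<in> J" "(j, k) \<in> J \<union> L" for i j k
      using normal_pattern_ideal(1)[OF KP normal[unfolded U_defs]] that K by blast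
    show "(i, k) \<in> J" if "(i, j) \<in> J \<union> L" "(j, k) \<in> J" for i j k
      using normal_pattern_ideal(2)[OF KP normal[unfolded U_defs]] that K by blast
  qed (use J L K disjoint in auto)
  then interpret pattern_pair J L .
  interpret V: group V
    unfolding V_def by (rule V_group_group)
  interpret CV: permutation_module U_K "V_set J" affine_act CV
    unfolding U_defs K(1) CV_def by (rule permutation_module_CV)
  have U_K: "U_K = U_group (J \<union> L)"
    by (simp add: U_defs K)
  have V_simps: "carrier V = V_set J" "A \<otimes>\<^bsub>V\<^esub> B = A + B" for A B
    by (simp_all add: V_def V_group_def)
  have JK: "carrier U_J \<subseteq> carrier U_K" and LK: "carrier U_L \<subseteq> carrier U_K"
    unfolding U_K U_defs(1,2) using U_group_mono by blast+
  have inv_K: "inv\<^bsub>U_K\<^esub> g \<in> carrier U_K" if "g \<in> carrier U_K" for g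
    using that by simp

  have basis: "complex_basis Vhat (carrier CV)"
  proof -
    have "complex_basis (characters V) (carrier (group_algebra V))"
    proof (rule V.complex_basis_characters)
      show "\<exists>\<psi>\<in>characters V. \<psi> A \<noteq> \<psi> B" if "A \<in> carrier V" "B \<in> carrier V" "A \<noteq> B" for A B
        unfolding V_def using that by (intro V_group_characters_separate) (simp_all add: V_simps)
    qed simp
    then show ?thesis
      by (simp add: Vhat_def CV.carrier_M V_simps)
  qed
  have f_in: "f (inv\<^bsub>U_K\<^esub> g) \<in> V_set J" if "g \<in> carrier U_K" for g
    using cocycle_in[of "inv\<^bsub>U_K\<^esub> g"] inv_K[OF that] by (simp add: f_def U_K)
  have char_nonzero: "\<psi> (f (inv\<^bsub>U_K\<^esub> g)) \<noteq> 0" if "g \<in> carrier U_K" "\<psi> \<in> Vhat" for g \<psi>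
    using that characters_nonzero[of \<psi> V] f_in by (simp add: Vhat_def V_simps)
  have bij: "bij_betw (\<lambda>\<psi>. dot_char J L \<psi> g) Vhat Vhat" if "g \<in> carrier U_K" for g
    using that bij_betw_dot_char by (simp add: Vhat_def V_def U_K)
  have monomial: "group_elem g \<odot>\<^bsub>CV\<^esub> \<psi> = fun_scale (\<psi> (f (inv\<^bsub>U_K\<^esub> g))) (dot_char J L \<psi> g)"
    if g: "g \<in> carrier U_K" and \<psi>: "\<psi> \<in> Vhat" for g \<psi>
  proof
    fix A
    show "(group_elem g \<odot>\<^bsub>CV\<^esub> \<psi>) A = fun_scale (\<psi> (f (inv\<^bsub>U_K\<^esub> g))) (dot_char J L \<psi> g) A"
    proof (cases "A \<in> V_set J")
      case True
      have in_V: "circ_act J L A (inv\<^bsub>U_K\<^esub> g) \<in> V_set J"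
        using circ_act_in[OF True, of "inv\<^bsub>U_K\<^esub> g"] inv_K[OF g] by (simp add: U_K)
      have "(group_elem g \<odot>\<^bsub>CV\<^esub> \<psi>) A = \<psi> (circ_act J L A (inv\<^bsub>U_K\<^esub> g) + f (inv\<^bsub>U_K\<^esub> g))"
        using CV.group_elem_act[OF g True] by (simp add: affine_act_def f_def)
      also have "\<dots> = \<psi> (circ_act J L A (inv\<^bsub>U_K\<^esub> g)) * \<psi> (f (inv\<^bsub>U_K\<^esub> g))"
        using \<psi> in_V f_in[OF g] characters_mult[of \<psi> V] by (simp add: Vhat_def V_simps)
      finally show ?thesis
        using True by (simp add: fun_scale_def dot_char_def U_K)
    next
      case False
      \<comment> \<open>Outside V both sides are the default value 0, built into the module action
        and into \<open>dot_char\<close>.\<close>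
      then show ?thesis
        by (simp add: CV.smult_M fun_scale_def dot_char_def)
    qed
  qed
  have induced: "right_module_isomorphic (group_algebra U_K) CV (induced_module U_L U_K (trivial_module U_L))"
  proof (rule CV.induced)
    show "(0 :: ('k, 'n) sq_matrix) \<in> V_set J"
      by (rule V_set_zero)
    show "\<exists>g\<in>carrier U_K. affine_act 0 g = A" if "A \<in> V_set J" for A :: "('k, 'n) sq_matrix"
    proof (rule bexI)
      have A: "mat 1 + A \<in> carrier (U_group J)"
        using that by (simp add: U_group_iff)
      then show "affine_act 0 (mat 1 + A) = A"
        by (simp add: affine_act_zero cocycle_J)
      show "mat 1 + A \<in> carrier U_K"
        using A JK by (auto simp: U_defs)
    qed
    show "carrier U_L = {g \<in> carrier U_K. affine_act 0 g = 0}"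
      using LK cocycle_eq_0_iff unfolding affine_act_zero U_K U_defs(2) by blast
  qed (simp_all add: U_defs)
  have regular: "right_module_isomorphic (group_algebra U_J) CV (regular_right_module (group_algebra U_J))"
  proof (rule CV.regular)
    show "group U_J"
      unfolding U_defs by (rule U_group_J)
    show "(0 :: ('k, 'n) sq_matrix) \<in> V_set J"
      by (rule V_set_zero)
    have "affine_act 0 g = g - mat 1" if "g \<in> carrier U_J" for g
      using that by (simp add: affine_act_zero cocycle_J U_defs)
    then show "bij_betw (affine_act 0) (carrier U_J) (V_set J)"
      by (intro bij_betw_byWitness[where f' = "\<lambda>A. mat 1 + A"]) (auto simp: U_defs U_group_iff)
  qed (use JK in \<open>simp_all add: U_defs\<close>)
  \<comment> \<open>Inverting twice returns \<open>g\<close>, so the value is \<rho>(g)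
    \<open>inv g\<close> - E, and \<rho> fixes \<open>g\<close>.\<close>
  have f_L: "f (inv\<^bsub>U_K\<^esub> g) = 0" if g: "g \<in> carrier U_L" for g
  proof -
    have gK: "g \<in> carrier U_K"
      using g LK by blast
    have "rho J g = g"
      using g by (simp add: rho_L U_defs)
    then show ?thesis
      using gK U_inv_mult[of g] by (simp add: f_def cocycle_def U_K)
  qed
  \<comment> \<open>0 + 0 = 0 makes the value at 0 idempotent, and it is nonzero.\<close>
  have char_one: "\<psi> 0 = 1" if "\<psi> \<in> Vhat" for \<psi>
    using that characters_mult[of \<psi> V 0 0] characters_nonzero[of \<psi> V 0]
    by (simp add: Vhat_def V_simps V_set_zero)
  have perm: "bij_betw (\<lambda>\<psi>. group_elem g \<odot>\<^bsub>CV\<^esub> \<psi>) Vhat Vhat" if g: "g \<in> carrier U_L" for g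
  proof -
    have gK: "g \<in> carrier U_K"
      using g LK by blast
    have "group_elem g \<odot>\<^bsub>CV\<^esub> \<psi> = dot_char J L \<psi> g" if "\<psi> \<in> Vhat" for \<psi>
      using monomial[OF gK that] by (simp add: f_L[OF g] char_one[OF that] fun_scale_def)
    then show ?thesis
      using bij[OF gK] by (simp cong: bij_betw_cong)
  qed
  show ?thesis
    using CV.right_module basis char_nonzero bij monomial induced regular f_L char_one perm by auto
qed

end
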